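(* Let $(\Omega,\mathcal{F},P)$ be a probability space, $(B,\|\cdot\|)$ a Banach space over $\mathbb{K}$ ($\mathbb{K}=\mathbb{R}$ or $\mathbb{C}$), $V$ a weakly compact convex subset with normal structure of $B$, and $\mathcal{T}$ a commutative family of strong random nonexpansive operators from $\Omega\times V$ to $V$. Then there is a strong random element $x^0(\cdot):\Omega\to V$ such that $T(\omega,x^0(\omega))=x^0(\omega)$ for almost all $\omega\in\Omega$ and all $T\in\mathcal{T}$.
   Context: Normal structure: a nonempty bounded closed convex set $K\subset B$ has normal structure if every nonempty closed convex subset $F$ of $K$ containing more than one point has a point $x\in F$ with $\sup\{\|x-y\|:y\in F\}<\sup\{\|z-y\|:y,z\in F\}$. For a metric space $M$, a map $X:\Omega\to M$ is a random element if $X^{-1}(U)\in\mathcal{F}$ for each open $U\subset M$; a random element is simple if it takes only finitely many values; $X$ is a strong random element if it is the pointwise limit of a sequence of simple random elements (equivalently, it is a random element with separable range). For metric spaces $(M,d)$, $(M_1,d_1)$, a map $T:\Omega\times M\to M_1$ is a random operator if $T(\cdot,x)$ is a random element for each $x\in M$, and a strong random operator if $T(\cdot,x)$ is a strong random element for each $x\in M$; it is random nonexpansive if for each $\omega\in\Omega$, $d_1(T(\omega,x),T(\omega,y))\le d(x,y)$ for all $x,y\in M$. A strong random nonexpansive operator is a strong random operator that is random nonexpansive. Here $V$ carries the metric induced by the norm. Two random operators $T_1,T_2:\Omega\times V\to V$ are commutative if for each $\omega\in\Omega$, $T_1(\omega,T_2(\omega,x))=T_2(\omega,T_1(\omega,x))$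 for all $x\in V$; a family is commutative if any two of its members are. *)

theory Defs
  imports "HOL-Probability.Probability"
begin

text \<open>
  The library has no class of complex normed spaces. A Banach space over \<open>\<bbbK>\<close> is therefore rendered
  as its underlying real Banach space (a type of class \<^class>\<open>banach\<close>) with a scalar multiplication
  \<open>smul\<close>. The scalar field is a subset \<open>K\<close> of the complex numbers, either \<^term>\<open>\<real> :: complex set\<close>
  or \<^term>\<open>UNIV :: complex set\<close>, and only scalars in \<open>K\<close> matter.
\<close>

definition banach_space_over ::
    "complex set \<Rightarrow> (complex \<Rightarrow> 'b::banach \<Rightarrow> 'b) \<Rightarrow> bool" where
  "banach_space_over K smul \<longleftrightarrow>
     (K = \<real> \<or> K = UNIV) \<and>
     (\<forall>a\<in>K. \<forall>x y. smul a (x + y) = smul a x + smul a y) \<and>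
     (\<forall>a\<in>K. \<forall>b\<in>K. \<forall>x. smul (a + b) x = smul a x + smul b x) \<and>
     (\<forall>a\<in>K. \<forall>b\<in>K. \<forall>x. smul (a * b) x = smul a (smul b x)) \<and>
     (\<forall>r x. smul (complex_of_real r) x = r *\<^sub>R x) \<and>
     (\<forall>a\<in>K. \<forall>x. norm (smul a x) = cmod a * norm x)"

lemma banach_space_over_real:
  "banach_space_over \<real> (\<lambda>a (x::'b::banach). Re a *\<^sub>R x)"
  by (auto simp: banach_space_over_def scaleR_add_right scaleR_add_left elim!: Reals_cases)

lemma banach_space_over_complex:
  "banach_space_over UNIV ((*) :: complex \<Rightarrow> complex \<Rightarrow> complex)"
  by (simp add: banach_space_over_def algebra_simps norm_mult scaleR_conv_of_real)

definition continuous_dual ::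
    "complex set \<Rightarrow> (complex \<Rightarrow> 'b::banach \<Rightarrow> 'b) \<Rightarrow> ('b \<Rightarrow> complex) set" where
  "continuous_dual K smul =
     {f. bounded_linear f \<and> range f \<subseteq> K \<and> (\<forall>a\<in>K. \<forall>x. f (smul a x) = a * f x)}"

definition weak_topology ::
    "complex set \<Rightarrow> (complex \<Rightarrow> 'b::banach \<Rightarrow> 'b) \<Rightarrow> 'b topology" where
  "weak_topology K smul =
     topology_generated_by {f -` U | f U. f \<in> continuous_dual K smul \<and> open U}"

definition weakly_compact ::
    "complex set \<Rightarrow> (complex \<Rightarrow> 'b::banach \<Rightarrow> 'b) \<Rightarrow> 'b set \<Rightarrow> bool" where
  "weakly_compact K smul V \<longleftrightarrow> compactin (weak_topology K smul) V"

definition normal_structure :: "'b::real_normed_vector set \<Rightarrow> bool" where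
  "normal_structure V \<longleftrightarrow>
     V \<noteq> {} \<and> bounded V \<and> closed V \<and> convex V \<and>
     (\<forall>F. F \<noteq> {} \<and> closed F \<and> convex F \<and> F \<subseteq> V \<and> (\<exists>a\<in>F. \<exists>b\<in>F. a \<noteq> b) \<longrightarrow>
        (\<exists>x\<in>F. Sup {norm (x - y) | y. y \<in> F} < Sup {norm (z - y) | y z. y \<in> F \<and> z \<in> F}))"

text \<open>
  The metric spaces in which random elements take their values are subsets \<open>S\<close> of a metric type,
  with the subspace metric. Functions on \<open>\<Omega>\<close> are only considered on \<^term>\<open>space P\<close>.
\<close>

definition random_element ::
    "'w measure \<Rightarrow> 'a::metric_space set \<Rightarrow> ('w \<Rightarrow> 'a) \<Rightarrow> bool" where
  "random_element P S X \<longleftrightarrow>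
     X \<in> space P \<rightarrow> S \<and>
     (\<forall>U. openin (top_of_set S) U \<longrightarrow> X -` U \<inter> space P \<in> sets P)"

definition simple_random_element ::
    "'w measure \<Rightarrow> 'a::metric_space set \<Rightarrow> ('w \<Rightarrow> 'a) \<Rightarrow> bool" where
  "simple_random_element P S X \<longleftrightarrow> random_element P S X \<and> finite (X ` space P)"

definition strong_random_element ::
    "'w measure \<Rightarrow> 'a::metric_space set \<Rightarrow> ('w \<Rightarrow> 'a) \<Rightarrow> bool" where
  "strong_random_element P S X \<longleftrightarrow>
     X \<in> space P \<rightarrow> S \<and>
     (\<exists>Xs :: nat \<Rightarrow> 'w \<Rightarrow> 'a. (\<forall>n. simple_random_element P S (Xs n)) \<and>
        (\<forall>\<omega>\<in>space P. (\<lambda>n. Xs n \<omega>) \<longlonglongrightarrow> X \<omega>))"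

definition strong_random_operator ::
    "'w measure \<Rightarrow> 'a set \<Rightarrow> 'b::metric_space set \<Rightarrow> ('w \<Rightarrow> 'a::metric_space \<Rightarrow> 'b) \<Rightarrow> bool" where
  "strong_random_operator P S S' T \<longleftrightarrow> (\<forall>x\<in>S. strong_random_element P S' (\<lambda>\<omega>. T \<omega> x))"

definition random_nonexpansive ::
    "'w measure \<Rightarrow> 'a::metric_space set \<Rightarrow> ('w \<Rightarrow> 'a \<Rightarrow> 'b::metric_space) \<Rightarrow> bool" where
  "random_nonexpansive P S T \<longleftrightarrow>
     (\<forall>\<omega>\<in>space P. \<forall>x\<in>S. \<forall>y\<in>S. dist (T \<omega> x) (T \<omega> y) \<le> dist x y)"

definition strong_random_nonexpansive_operator ::
    "'w measure \<Rightarrow> 'a set \<Rightarrow> 'b::metric_space set \<Rightarrow> ('w \<Rightarrow> 'a::metric_space \<Rightarrow> 'b) \<Rightarrow> bool" where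
  "strong_random_nonexpansive_operator P S S' T \<longleftrightarrow>
     strong_random_operator P S S' T \<and> random_nonexpansive P S T"

definition commutative_operators ::
    "'w measure \<Rightarrow> 'a set \<Rightarrow> ('w \<Rightarrow> 'a \<Rightarrow> 'a) \<Rightarrow> ('w \<Rightarrow> 'a \<Rightarrow> 'a) \<Rightarrow> bool" where
  "commutative_operators P S T\<^sub>1 T\<^sub>2 \<longleftrightarrow>
     (\<forall>\<omega>\<in>space P. \<forall>x\<in>S. T\<^sub>1 \<omega> (T\<^sub>2 \<omega> x) = T\<^sub>2 \<omega> (T\<^sub>1 \<omega> x))"

definition commutative_family ::
    "'w measure \<Rightarrow> 'a set \<Rightarrow> ('w \<Rightarrow> 'a \<Rightarrow> 'a) set \<Rightarrow> bool" where
  "commutative_family P S \<T> \<longleftrightarrow> (\<forall>T\<^sub>1\<in>\<T>. \<forall>T\<^sub>2\<in>\<T>. commutative_operators P S T\<^sub>1 T\<^sub>2)"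

end

theory Submission
  imports Defs
begin

text \<open>
  Fixed points chosen separately for every \<open>\<omega>\<close> need not depend measurably on \<open>\<omega>\<close>, and an
  uncountable family leaves no common exceptional null set to work outside of. The proof therefore
  carries out a deterministic argument, the method of asymptotic centres for commuting nonexpansive
  maps, with the strong random elements of \<open>V\<close> themselves as points, on which the operators act
  pointwise, and it uses only countably many steps.

  Let \<open>S\<close> be the commutative monoid of operators generated by the family. A set \<open>D\<close> of strong random
  elements is called admissible if it is nonempty, convex, \<open>S\<close>-invariant, closed in the \<open>L\<^sup>1\<close> sense,
  and closed under gluing two of its elements along a measurable set. By commutativity the sets
  \<open>\<sigma> D\<close> with \<open>\<sigma> \<in> S\<close> are directed downwards, and \<open>radius D A z\<close> is the asymptotic radius about \<open>z\<close> of this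
  net, with distances integrated over the event \<open>A\<close>. Gluing makes it additive in \<open>A\<close>, which replaces
  a radius at each single \<open>\<omega>\<close>. It is convex and continuous in \<open>z\<close>, and nonexpansiveness gives
  \<open>radius D A (\<sigma> z) \<le> radius D A z\<close>; so its sublevel sets are admissible.

  A decreasing sequence of admissible sets has an admissible intersection: a measurable selection
  from the intersections of the closed convex tails of a sequence lies in all of them. Hence some
  admissible \<open>D\<close> has a value of \<open>sup\<^sub>z radius D \<Omega> z\<close> that no admissible subset can lower. Cutting
  \<open>D\<close> down to a sublevel set shows that the radius does not depend on \<open>z \<in> D\<close>, and gluing shows the
  same over every event. One can then choose \<open>y\<^sub>0, y\<^sub>1, \<dots>\<close> in \<open>D\<close> such that \<open>y\<^sub>m\<close> is, up to a small
  error, at most the common radius away from each earlier \<open>y\<^sub>i\<close> and at least the common radius away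
  from their average. By the Borel-Cantelli lemma almost every path of this sequence is
  asymptotically diametral in \<open>V\<close>. Moving such a path slightly towards a common point of the closed
  convex hulls of its tails makes it diametral, which normal structure allows only if the radius
  vanishes. Thus the elements of \<open>D\<close> agree almost surely, and the invariance of \<open>D\<close> makes them fixed.

  Weak compactness enters through one consequence: a decreasing sequence of nonempty closed convex
  subsets of \<open>V\<close> has a common point. This rests on the Hahn-Banach separation theorem.
\<close>

section \<open>Hahn-Banach separation and weak compactness\<close>

definition sublinear :: "('b::real_vector \<Rightarrow> real) \<Rightarrow> bool" where
  "sublinear q \<longleftrightarrow> (\<forall>x y. q (x + y) \<le> q x + q y) \<and> (\<forall>a>0. \<forall>x. q (a *\<^sub>R x) \<le> a * q x)"

lemma sublinear_add: "sublinear q \<Longrightarrow> q (x + y) \<le> q x + q y"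
  by (simp add: sublinear_def)

lemma sublinear_scale_le: "sublinear q \<Longrightarrow> a > 0 \<Longrightarrow> q (a *\<^sub>R x) \<le> a * q x"
  by (simp add: sublinear_def)

lemma sublinear_zero:
  assumes "sublinear q" shows "q 0 = 0"
  using sublinear_scale_le[OF assms, of 2 0] sublinear_scale_le[OF assms, of "1/2" 0] by simp

lemma sublinear_scale:
  assumes "sublinear q" "a \<ge> 0" shows "q (a *\<^sub>R x) = a * q x"
proof (cases "a = 0")
  case False
  then have a: "a > 0" using assms by simp
  have "q ((1/a) *\<^sub>R (a *\<^sub>R x)) \<le> (1/a) * q (a *\<^sub>R x)"
    by (rule sublinear_scale_le[OF assms(1)]) (use a in simp)
  then have "a * q x \<le> q (a *\<^sub>R x)" using a by (simp add: field_simps)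
  then show ?thesis using sublinear_scale_le[OF assms(1) a, of x] by simp
qed (simp add: sublinear_zero assms)

lemma sublinear_minus: "sublinear q \<Longrightarrow> - q (- x) \<le> q x"
  using sublinear_add[of q x "-x"] sublinear_zero[of q] by simp

text \<open>
  Subtracting the slope of \<open>q\<close> in the direction \<open>y\<close> as far as possible keeps \<open>q\<close> sublinear and
  moves it down. For a minimal \<open>q\<close> nothing can change, and the last inequality then says that \<open>q\<close> is
  superadditive.
\<close>

lemma sublinear_shift_inf:
  fixes q :: "'b::real_vector \<Rightarrow> real" and x y :: 'b
  assumes q: "sublinear q"
  defines "q' \<equiv> \<lambda>x. INF t\<in>{0..}. q (x + t *\<^sub>R y) - t * q y"
  shows "sublinear q'" "q' x \<le> q x" "q' x \<le> q (x + y) - q y"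
proof -
  have bdd: "bdd_below ((\<lambda>t. q (x + t *\<^sub>R y) - t * q y) ` {0..})" for x
  proof (rule bdd_belowI2[of _ "- q (- x)"])
    fix t :: real assume "t \<in> {0..}"
    then have "t * q y = q ((x + t *\<^sub>R y) + (- x))" by (simp add: sublinear_scale[OF q])
    also have "\<dots> \<le> q (x + t *\<^sub>R y) + q (- x)" by (rule sublinear_add[OF q])
    finally show "- q (- x) \<le> q (x + t *\<^sub>R y) - t * q y" by simp
  qed
  have low: "q' x \<le> q (x + t *\<^sub>R y) - t * q y" if "t \<ge> 0" for x t
    unfolding q'_def by (rule cINF_lower[OF bdd]) (use that in simp)
  show "q' x \<le> q x" using low[of 0 x] by simp
  show "q' x \<le> q (x + y) - q y" using low[of 1 x] by simp
  show "sublinear q'" unfolding sublinear_def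
  proof (intro conjI allI impI)
    fix x z
    have 1: "q' (x + z) - (q (z + t' *\<^sub>R y) - t' * q y) \<le> q (x + t *\<^sub>R y) - t * q y"
      if "t \<ge> 0" "t' \<ge> 0" for t t'
    proof -
      have "q' (x + z) \<le> q ((x + t *\<^sub>R y) + (z + t' *\<^sub>R y)) - (t + t') * q y"
        using low[of "t + t'" "x + z"] that by (simp add: algebra_simps)
      then show ?thesis using sublinear_add[OF q, of "x + t *\<^sub>R y" "z + t' *\<^sub>R y"]
        by (simp add: algebra_simps)
    qed
    have 2: "q' (x + z) - (q (z + t' *\<^sub>R y) - t' * q y) \<le> q' x" if "t' \<ge> 0" for t'
      unfolding q'_def[THEN meta_eq_to_obj_eq, THEN fun_cong, of x]
      by (rule cINF_greatest) (use 1 that in auto)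
    have "q' (x + z) - q' x \<le> q' z"
      unfolding q'_def[THEN meta_eq_to_obj_eq, THEN fun_cong, of z]
      by (rule cINF_greatest) (use 2 in force)+
    then show "q' (x + z) \<le> q' x + q' z" by simp
  next
    fix a :: real and x assume a: "a > 0"
    have "q' (a *\<^sub>R x) / a \<le> q' x"
      unfolding q'_def[THEN meta_eq_to_obj_eq, THEN fun_cong, of x]
    proof (rule cINF_greatest)
      fix t :: real assume t: "t \<in> {0..}"
      have "q' (a *\<^sub>R x) \<le> q (a *\<^sub>R (x + t *\<^sub>R y)) - (a * t) * q y"
        using low[of "a * t" "a *\<^sub>R x"] a t by (simp add: scaleR_add_right)
      also have "\<dots> = a * (q (x + t *\<^sub>R y) - t * q y)"
        using sublinear_scale[OF q, of a "x + t *\<^sub>R y"] a by (simp add: right_diff_distrib)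
      finally show "q' (a *\<^sub>R x) / a \<le> q (x + t *\<^sub>R y) - t * q y"
        using a by (simp add: pos_divide_le_eq mult.commute)
    qed simp
    then show "q' (a *\<^sub>R x) \<le> a * q' x" using a by (simp add: field_simps)
  qed
qed

lemma minimal_sublinear_linear:
  fixes q :: "'b::real_vector \<Rightarrow> real"
  assumes q: "sublinear q" and min: "\<And>q'. sublinear q' \<Longrightarrow> (\<And>x. q' x \<le> q x) \<Longrightarrow> q' = q"
  shows "linear q"
proof -
  have add: "q (x + y) = q x + q y" for x y
  proof -
    \<comment> \<open>The shifted functional lies below \<open>q\<close>, hence equals it.\<close>
    have eq: "(\<lambda>x. INF t\<in>{0..}. q (x + t *\<^sub>R y) - t * q y) = q"
      by (rule min[OF sublinear_shift_inf(1,2)[OF q]])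
    have "q x = (INF t\<in>{0..}. q (x + t *\<^sub>R y) - t * q y)" by (rule fun_cong[OF eq, symmetric])
    also have "\<dots> \<le> q (x + y) - q y" by (rule sublinear_shift_inf(3)[OF q])
    finally have "q x \<le> q (x + y) - q y" .
    then show ?thesis using sublinear_add[OF q, of x y] by simp
  qed
  have neg: "q (- x) = - q x" for x
    using add[of x "-x"] sublinear_zero[OF q] by simp
  show ?thesis
  proof (rule linearI)
    fix r x
    show "q (r *\<^sub>R x) = r *\<^sub>R q x"
    proof (cases "r \<ge> 0")
      case False
      then have "q ((-r) *\<^sub>R x) = (-r) * q x" using sublinear_scale[OF q, of "-r" x] by simp
      then show ?thesis using neg[of "r *\<^sub>R x"] by simp
    qed (simp add: sublinear_scale[OF q])
  qed (rule add)
qed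

text \<open>
  The Hahn-Banach theorem without partially defined functionals: by Zorn's lemma some sublinear
  functional below \<open>p\<close> is minimal, and minimal ones are linear.
\<close>

lemma linear_below_sublinear:
  fixes p :: "'b::real_vector \<Rightarrow> real"
  assumes p: "sublinear p"
  shows "\<exists>f. linear f \<and> (\<forall>x. f x \<le> p x)"
proof -
  define A where "A = {q. sublinear q \<and> (\<forall>x. q x \<le> p x)}"
  define R where "R = (\<lambda>(f::'b \<Rightarrow> real) g. \<forall>x. g x \<le> f x)"
  have "\<exists>m\<in>A. \<forall>a\<in>A. R m a \<longrightarrow> a = m"
  proof (rule predicate_Zorn)
    show "partial_order_on A (relation_of R A)"
      by (rule partial_order_on_relation_ofI) (auto simp: R_def fun_eq_iff intro: order_trans antisym)
  next
    fix C assume C: "C \<in> Chains (relation_of R A)"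
    then have CA: "C \<subseteq> A" and ch: "\<And>f g. f \<in> C \<Longrightarrow> g \<in> C \<Longrightarrow> R f g \<or> R g f"
      by (auto simp: Chains_def relation_of_def)
    show "\<exists>u\<in>A. \<forall>a\<in>C. R a u"
    proof (cases "C = {}")
      case True
      then show ?thesis using p by (auto simp: A_def)
    next
      case False
      define u where "u = (\<lambda>x. INF q\<in>C. q x)"
      have bdd: "bdd_below ((\<lambda>q. q x) ` C)" for x
      proof (rule bdd_belowI2[of _ "- p (- x)"])
        fix q assume "q \<in> C"
        then have "sublinear q" "q (-x) \<le> p (- x)" using CA by (auto simp: A_def)
        then show "- p (- x) \<le> q x" using sublinear_minus[of q x] by simp
      qed
      have low: "u x \<le> q x" if "q \<in> C" for q x
        unfolding u_def by (rule cINF_lower[OF bdd that])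
      have "sublinear u" unfolding sublinear_def
      proof (intro conjI allI impI)
        fix x y
        have 1: "u (x + y) - q2 y \<le> q1 x" if q12: "q1 \<in> C" "q2 \<in> C" for q1 q2
        proof -
          obtain q where "q \<in> C" "q x \<le> q1 x" "q y \<le> q2 y"
            using ch[OF q12] q12 by (auto simp: R_def)
          moreover have "sublinear q" using CA \<open>q \<in> C\<close> by (auto simp: A_def)
          ultimately show ?thesis using low[of q "x + y"] sublinear_add[of q x y] by simp
        qed
        have 2: "u (x + y) - q2 y \<le> u x" if "q2 \<in> C" for q2
          unfolding u_def[THEN fun_cong, of x] by (rule cINF_greatest[OF False]) (use 1 that in auto)
        have "u (x + y) - u x \<le> u y"
          unfolding u_def[THEN fun_cong, of y] by (rule cINF_greatest[OF False]) (use 2 in force)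
        then show "u (x + y) \<le> u x + u y" by simp
      next
        fix a :: real and x assume a: "a > 0"
        have "u (a *\<^sub>R x) / a \<le> u x"
          unfolding u_def[THEN fun_cong, of x]
        proof (rule cINF_greatest[OF False])
          fix q assume "q \<in> C"
          moreover have "sublinear q" using CA \<open>q \<in> C\<close> by (auto simp: A_def)
          ultimately have "u (a *\<^sub>R x) \<le> a * q x"
            using low[of q "a *\<^sub>R x"] sublinear_scale_le[of q a x] a by simp
          then show "u (a *\<^sub>R x) / a \<le> q x" using a by (simp add: field_simps)
        qed
        then show "u (a *\<^sub>R x) \<le> a * u x" using a by (simp add: field_simps)
      qed
      moreover have "u x \<le> p x" for x
      proof -
        obtain q where "q \<in> C" using False by auto
        then have "u x \<le> q x" "q x \<le> p x" using low[of q x] CA by (auto simp: A_def)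
        then show ?thesis by simp
      qed
      ultimately show ?thesis using low by (auto simp: A_def R_def)
    qed
  qed
  then obtain m where m: "m \<in> A" "\<And>a. a \<in> A \<Longrightarrow> R m a \<Longrightarrow> a = m" by auto
  have "linear m"
  proof (rule minimal_sublinear_linear)
    show "sublinear m" using m by (simp add: A_def)
    fix q' assume "sublinear q'" "\<And>x. q' x \<le> m x"
    then show "q' = m" using m by (intro m(2)) (auto simp: A_def R_def intro: order_trans)
  qed
  then show ?thesis using m(1) by (auto simp: A_def)
qed

text \<open>
  The separating functional is any linear one below
  \<open>p v = inf (norm (v + t (c - x0)) - t d)\<close>, where \<open>t \<ge> 0\<close>, \<open>c \<in> C\<close> and \<open>d\<close> is the distance from \<open>x0\<close>
  to \<open>C\<close>. The choice \<open>t = 0\<close> bounds \<open>p\<close> by the norm, which gives continuity, and \<open>t = 1\<close> gives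
  \<open>p (x0 - c) \<le> - d\<close>, which gives the gap.
\<close>

lemma closed_convex_strict_separation:
  fixes C :: "'b::real_normed_vector set"
  assumes "closed C" "convex C" "C \<noteq> {}" "x0 \<notin> C"
  shows "\<exists>f::'b \<Rightarrow> real. bounded_linear f \<and> (\<exists>d>0. \<forall>c\<in>C. f x0 + d \<le> f c)"
proof -
  define d where "d = infdist x0 C"
  have d0: "d > 0" unfolding d_def using assms by (simp add: infdist_pos_not_in_closed)
  have d: "d \<le> norm (c - x0)" if "c \<in> C" for c
    using infdist_le[OF that, of x0] by (simp add: d_def dist_norm norm_minus_commute)
  define h where "h = (\<lambda>v (t,c). norm (v + t *\<^sub>R (c - x0)) - t * d)"
  define p where "p = (\<lambda>v. INF tc\<in>{0..} \<times> C. h v tc)"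
  have ne: "{0..} \<times> C \<noteq> ({}::(real\<times>'b) set)" using assms by auto
  have bdd: "bdd_below (h v ` ({0..} \<times> C))" for v
  proof (rule bdd_belowI2[of _ "- norm v"])
    fix b :: "real \<times> 'b" assume "b \<in> {0..} \<times> C"
    then obtain t c where b: "b = (t, c)" and tc: "t \<in> {0..}" "c \<in> C" by auto
    have "t * d \<le> norm (t *\<^sub>R (c - x0))" using d[OF tc(2)] tc by (simp add: mult_left_mono)
    also have "\<dots> = norm ((v + t *\<^sub>R (c - x0)) - v)" by simp
    also have "\<dots> \<le> norm (v + t *\<^sub>R (c - x0)) + norm v" by (rule norm_triangle_ineq4)
    finally show "- norm v \<le> h v b" by (simp add: b h_def)
  qed
  have low: "p v \<le> norm (v + t *\<^sub>R (c - x0)) - t * d" if "t \<ge> 0" "c \<in> C" for v t c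
    using cINF_lower[OF bdd, of "(t,c)" v] that by (simp add: h_def p_def)
  have "sublinear p" unfolding sublinear_def
  proof (intro conjI allI impI)
    fix x y
    have 1: "p (x + y) - h y b \<le> h x a" if a: "a \<in> {0..} \<times> C" and b: "b \<in> {0..} \<times> C" for a b
    proof -
      obtain t c t' c' where ab: "a = (t,c)" "b = (t',c')" "t \<ge> 0" "t' \<ge> 0" "c \<in> C" "c' \<in> C"
        using a b by auto
      have "\<exists>c''\<in>C. (t + t') *\<^sub>R (c'' - x0) = t *\<^sub>R (c - x0) + t' *\<^sub>R (c' - x0)"
      proof (cases "t + t' = 0")
        case True
        then have "t = 0" "t' = 0" using ab by auto
        then show ?thesis using ab by auto
      next
        case False
        then have pos: "t + t' > 0" using ab by auto
        let ?c = "(t/(t+t')) *\<^sub>R c + (t'/(t+t')) *\<^sub>R c'"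
        have "?c \<in> C" using pos ab
          by (intro convexD[OF assms(2)]) (auto simp: add_divide_distrib[symmetric])
        moreover have "(t + t') *\<^sub>R ?c = t *\<^sub>R c + t' *\<^sub>R c'" using False by (simp add: scaleR_add_right)
        ultimately show ?thesis
          by (intro bexI[of _ ?c]) (simp_all add: scaleR_diff_right scaleR_add_left)
      qed
      then obtain c'' where c'': "c'' \<in> C" "(t + t') *\<^sub>R (c'' - x0) = t *\<^sub>R (c - x0) + t' *\<^sub>R (c' - x0)"
        by auto
      have "p (x + y) \<le> norm ((x + y) + (t + t') *\<^sub>R (c'' - x0)) - (t + t') * d"
        using low[of "t + t'" c'' "x + y"] ab c''(1) by simp
      also have "(x + y) + (t + t') *\<^sub>R (c'' - x0) = (x + t *\<^sub>R (c - x0)) + (y + t' *\<^sub>R (c' - x0))"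
        unfolding c''(2) by simp
      finally show ?thesis using norm_triangle_ineq[of "x + t *\<^sub>R (c - x0)" "y + t' *\<^sub>R (c' - x0)"]
        unfolding ab h_def by (simp add: algebra_simps)
    qed
    have 2: "p (x + y) - h y b \<le> p x" if "b \<in> {0..} \<times> C" for b
      unfolding p_def[THEN fun_cong, of x] by (rule cINF_greatest[OF ne]) (use 1[OF _ that] in force)
    have "p (x + y) - p x \<le> p y"
      unfolding p_def[THEN fun_cong, of y]
      by (rule cINF_greatest[OF ne]) (use 2 in \<open>force simp: algebra_simps\<close>)
    then show "p (x + y) \<le> p x + p y" by simp
  next
    fix a :: real and x assume a: "a > 0"
    have "p (a *\<^sub>R x) / a \<le> p x"
      unfolding p_def[THEN fun_cong, of x]
    proof (rule cINF_greatest[OF ne])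
      fix b :: "real \<times> 'b" assume "b \<in> {0..} \<times> C"
      then obtain t c where b: "b = (t,c)" "t \<ge> 0" "c \<in> C" by auto
      have "p (a *\<^sub>R x) \<le> norm (a *\<^sub>R (x + t *\<^sub>R (c - x0))) - a * t * d"
        using low[of "a * t" c "a *\<^sub>R x"] a b by (simp add: scaleR_add_right)
      also have "\<dots> = a * h x b" using a by (simp add: b h_def right_diff_distrib del: scaleR_add_right)
      finally show "p (a *\<^sub>R x) / a \<le> h x b" using a by (simp add: pos_divide_le_eq mult.commute)
    qed
    then show "p (a *\<^sub>R x) \<le> a * p x" using a by (simp add: field_simps)
  qed
  then obtain f where f: "linear f" "\<And>x. f x \<le> p x" using linear_below_sublinear by blast
  have pn: "p v \<le> norm v" for v using low[of 0 _ v] assms by auto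
  have "norm (f v) \<le> norm v * 1" for v
    using f(2)[of v] f(2)[of "-v"] pn[of v] pn[of "-v"] linear_neg[OF f(1), of v] by simp
  then have "bounded_linear f" using f(1)
    by (intro bounded_linear_intro[of f 1]) (auto simp: linear_add linear_scale)
  moreover have "f x0 + d \<le> f c" if "c \<in> C" for c
    using f(2)[of "x0 - c"] low[of 1 c "x0 - c"] that f(1) by (simp add: linear_diff)
  ultimately show ?thesis using d0 by blast
qed

text \<open>
  In the complex case \<open>f\<close> is the real part of \<open>x \<mapsto> f x - \<i> f (\<i> x)\<close>.
\<close>

lemma continuous_dual_real_part:
  fixes f :: "'b::banach \<Rightarrow> real"
  assumes B: "banach_space_over K smul" and f: "bounded_linear f"
  shows "\<exists>g \<in> continuous_dual K smul. \<forall>x. Re (g x) = f x"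
proof -
  interpret f: bounded_linear f by fact
  have smul_real: "smul (complex_of_real r) x = r *\<^sub>R x" for r x
    using B by (simp add: banach_space_over_def)
  consider "K = \<real>" | "K = UNIV" using B by (auto simp: banach_space_over_def)
  then show ?thesis
  proof cases
    case 1
    have "bounded_linear (\<lambda>x. complex_of_real (f x))"
      using bounded_linear_compose[OF bounded_linear_of_real f] by (simp add: o_def)
    then have "(\<lambda>x. complex_of_real (f x)) \<in> continuous_dual K smul"
      by (auto simp: continuous_dual_def 1 smul_real f.scaleR elim!: Reals_cases)
    then show ?thesis by (intro bexI) auto
  next
    case 2
    note B' = B[unfolded banach_space_over_def 2, simplified]
    define J where "J = smul \<i>"
    have J_add: "J (x + y) = J x + J y" for x y using B' by (simp add: J_def)
    have smul_mult: "smul a (smul b x) = smul (a * b) x" for a b x using B' by simp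
    have smul_add: "smul (a + b) x = smul a x + smul b x" for a b x using B' by simp
    have J_scale: "J (r *\<^sub>R x) = r *\<^sub>R J x" for r x
      unfolding J_def smul_real[symmetric] smul_mult by (simp add: mult.commute)
    have J_norm: "norm (J x) = norm x" for x using B' by (simp add: J_def)
    have J_bl: "bounded_linear J"
      by (rule bounded_linear_intro[where K = 1]) (simp_all add: J_add J_scale J_norm)
    have JJ: "J (J x) = - x" for x
      using smul_real[of "-1" x] by (simp add: J_def smul_mult)
    interpret J: bounded_linear J by fact
    define g where "g = (\<lambda>x. complex_of_real (f x) - \<i> * complex_of_real (f (J x)))"
    have "bounded_linear (\<lambda>x. \<i> * complex_of_real (f (J x)))"
      by (rule bounded_linear_compose[OF bounded_linear_mult_right
            bounded_linear_compose[OF bounded_linear_of_real bounded_linear_compose[OF f J_bl]]])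
    then have g_bl: "bounded_linear g" unfolding g_def
      by (rule bounded_linear_sub[OF bounded_linear_compose[OF bounded_linear_of_real f]])
    interpret g: bounded_linear g by fact
    have "g (smul a x) = a * g x" for a x
    proof -
      have "smul a x = Re a *\<^sub>R x + Im a *\<^sub>R J x"
      proof -
        have "smul a x = smul (complex_of_real (Re a) + complex_of_real (Im a) * \<i>) x"
          by (rule arg_cong[where f = "\<lambda>b. smul b x"]) (simp add: complex_eq_iff)
        also have "\<dots> = Re a *\<^sub>R x + Im a *\<^sub>R J x"
          by (simp only: smul_add smul_mult[symmetric] smul_real J_def)
        finally show ?thesis .
      qed
      moreover have "g (J x) = \<i> * g x" by (simp add: g_def JJ f.neg algebra_simps)
      ultimately have "g (smul a x) = (complex_of_real (Re a) + complex_of_real (Im a) * \<i>) * g x"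
        by (simp add: g.add g.scaleR scaleR_conv_of_real algebra_simps)
      moreover have "complex_of_real (Re a) + complex_of_real (Im a) * \<i> = a"
        by (simp add: complex_eq_iff)
      ultimately show ?thesis by simp
    qed
    then have "g \<in> continuous_dual K smul" using g_bl by (simp add: continuous_dual_def 2)
    moreover have "Re (g x) = f x" for x by (simp add: g_def)
    ultimately show ?thesis by blast
  qed
qed

lemma openin_weak_topology_Compl:
  fixes C :: "'b::banach set"
  assumes B: "banach_space_over K smul" and C: "closed C" "convex C"
  shows "openin (weak_topology K smul) (- C)"
proof (cases "C = {}")
  case True
  have "(\<lambda>x. 0) -` UNIV \<in> {f -` U | f U. f \<in> continuous_dual K smul \<and> open U}"
    using B by (intro CollectI exI[of _ "\<lambda>x. 0"] exI[of _ UNIV])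
      (auto simp: continuous_dual_def banach_space_over_def)
  then show ?thesis using True unfolding weak_topology_def
    by (intro topology_generated_by_Basis) simp
next
  case False
  show ?thesis
  proof (subst openin_subopen, intro ballI)
    fix x assume "x \<in> - C"
    then obtain f :: "'b \<Rightarrow> real" and d where f: "bounded_linear f" "d > 0" "\<And>c. c \<in> C \<Longrightarrow> f x + d \<le> f c"
      using closed_convex_strict_separation[OF C False, of x] by auto
    obtain g where g: "g \<in> continuous_dual K smul" "\<And>x. Re (g x) = f x"
      using continuous_dual_real_part[OF B f(1)] by auto
    have "open {z. Re z < f x + d}" by (rule open_halfspace_Re_lt)
    then have "openin (weak_topology K smul) (g -` {z. Re z < f x + d})"
      unfolding weak_topology_def using g(1) by (intro topology_generated_by_Basis) blast
    then show "\<exists>T. openin (weak_topology K smul) T \<and> x \<in> T \<and> T \<subseteq> - C"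
      using f g by (intro exI[of _ "g -` {z. Re z < f x + d}"]) force
  qed
qed

lemma weakly_compact_decseq_Inter:
  fixes C :: "nat \<Rightarrow> 'b::banach set"
  assumes B: "banach_space_over K smul" and V: "weakly_compact K smul V"
    and C: "\<And>n. closed (C n)" "\<And>n. convex (C n)" "\<And>n. C n \<noteq> {}" "\<And>n. C n \<subseteq> V" "decseq C"
  shows "(\<Inter>n. C n) \<noteq> {}"
proof
  assume empty: "(\<Inter>n. C n) = {}"
  have "compactin (weak_topology K smul) V" using V by (simp add: weakly_compact_def)
  moreover have "\<And>U. U \<in> range (\<lambda>n. - C n) \<Longrightarrow> openin (weak_topology K smul) U"
    using openin_weak_topology_Compl[OF B C(1,2)] by auto
  moreover have "V \<subseteq> \<Union> (range (\<lambda>n. - C n))" using empty by auto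
  ultimately obtain F where F: "finite F" "F \<subseteq> range (\<lambda>n. - C n)" "V \<subseteq> \<Union> F"
    by (meson compactinD)
  then obtain N where N: "finite N" "F = (\<lambda>n. - C n) ` N"
    by (meson finite_subset_image)
  define m where "m = Max (insert 0 N)"
  obtain x where x: "x \<in> C m" using C(3) by auto
  then obtain n where "n \<in> N" "x \<notin> C n" using F N C(4) by blast
  moreover have "n \<le> m" using N \<open>n \<in> N\<close> by (simp add: m_def)
  ultimately show False using C(5) x by (auto simp: decseq_def)
qed

section \<open>Diametral sequences and normal structure\<close>

text \<open>
  If \<open>v\<close> is within about \<open>c\<close> of all \<open>y i\<close> and at least about \<open>c\<close> from their average, then it is at
  least about \<open>c\<close> from every convex combination \<open>x\<close> of them: the average is a mixture of \<open>x\<close>, with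
  weight \<open>1/m\<close>, and of other points that are within \<open>c + e\<close>. One lower bound thus controls
  all combinations at once.
\<close>

lemma weighted_sum_far:
  fixes y :: "nat \<Rightarrow> 'b::real_normed_vector"
  assumes m: "m > 0" and \<alpha>: "\<And>i. i < m \<Longrightarrow> 0 \<le> \<alpha> i" "(\<Sum>i<m. \<alpha> i) = 1"
    and near: "\<And>i. i < m \<Longrightarrow> norm (v - y i) \<le> c + e"
    and far: "norm (v - (\<Sum>i<m. y i) /\<^sub>R real m) \<ge> c - e"
  shows "norm (v - (\<Sum>i<m. \<alpha> i *\<^sub>R y i)) \<ge> c - 2 * real m * e + e"
proof -
  define x where "x = (\<Sum>i<m. \<alpha> i *\<^sub>R y i)"
  have \<alpha>1: "\<alpha> i \<le> 1" if "i < m" for i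
    using member_le_sum[of i "{..<m}" \<alpha>] that \<alpha> by simp
  have "v = (\<Sum>i<m. \<alpha> i *\<^sub>R v)" by (simp add: \<alpha>(2) flip: scaleR_sum_left)
  \<comment> \<open>All weights \<open>1 - \<alpha> i\<close> are nonnegative and they add up to \<open>m - 1\<close>.\<close>
  then have "real m *\<^sub>R (v - (\<Sum>i<m. y i) /\<^sub>R real m) = (v - x) + (\<Sum>i<m. (1 - \<alpha> i) *\<^sub>R (v - y i))"
    using m by (simp add: x_def scaleR_diff_left scaleR_diff_right sum_subtractf sum_constant_scaleR)
  then have "norm (real m *\<^sub>R (v - (\<Sum>i<m. y i) /\<^sub>R real m))
      \<le> norm (v - x) + norm (\<Sum>i<m. (1 - \<alpha> i) *\<^sub>R (v - y i))"
    by (metis norm_triangle_ineq)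
  moreover have "norm (\<Sum>i<m. (1 - \<alpha> i) *\<^sub>R (v - y i)) \<le> (\<Sum>i<m. (1 - \<alpha> i) * (c + e))"
    by (rule sum_norm_le) (use \<alpha>1 near in \<open>auto intro!: mult_left_mono\<close>)
  moreover have "(\<Sum>i<m. (1 - \<alpha> i) * (c + e)) = (real m - 1) * (c + e)"
    by (simp add: \<alpha>(2) sum_subtractf flip: sum_distrib_right)
  moreover have "real m * (c - e) \<le> norm (real m *\<^sub>R (v - (\<Sum>i<m. y i) /\<^sub>R real m))"
    using far by (simp add: mult_left_mono)
  ultimately have "real m * (c - e) \<le> norm (v - x) + (real m - 1) * (c + e)" by linarith
  then show ?thesis unfolding x_def by (simp add: algebra_simps)
qed

lemma convex_hull_sequence_weights:
  fixes y :: "nat \<Rightarrow> 'b::real_vector"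
  assumes "x \<in> convex hull (range y)"
  shows "\<exists>N. \<forall>m\<ge>N. \<exists>\<alpha>. (\<forall>i. 0 \<le> \<alpha> i) \<and> (\<Sum>i<m. \<alpha> i) = (1::real) \<and> (\<Sum>i<m. \<alpha> i *\<^sub>R y i) = x"
proof -
  define Q where "Q = {x. \<exists>N. \<forall>m\<ge>N. \<exists>\<alpha>. (\<forall>i. 0 \<le> \<alpha> i) \<and> (\<Sum>i<m. \<alpha> i) = (1::real) \<and> (\<Sum>i<m. \<alpha> i *\<^sub>R y i) = x}"
  have "range y \<subseteq> Q"
  proof clarify
    fix k
    have "\<exists>\<alpha>. (\<forall>i. 0 \<le> \<alpha> i) \<and> (\<Sum>i<m. \<alpha> i) = (1::real) \<and> (\<Sum>i<m. \<alpha> i *\<^sub>R y i) = y k" if "m \<ge> Suc k" for m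
      using that by (intro exI[of _ "\<lambda>i. if i = k then 1 else 0"])
        (auto simp: if_distrib[of "\<lambda>a. a *\<^sub>R _"] sum.delta cong: if_cong)
    then show "y k \<in> Q" unfolding Q_def by blast
  qed
  moreover have "convex Q"
  proof (rule convexI)
    fix u v and s t :: real assume uv: "u \<in> Q" "v \<in> Q" and st: "0 \<le> s" "0 \<le> t" "s + t = 1"
    obtain N1 where N1: "\<And>m. m \<ge> N1 \<Longrightarrow> \<exists>\<alpha>. (\<forall>i. 0 \<le> \<alpha> i) \<and> (\<Sum>i<m. \<alpha> i) = (1::real) \<and> (\<Sum>i<m. \<alpha> i *\<^sub>R y i) = u"
      using uv unfolding Q_def by blast
    obtain N2 where N2: "\<And>m. m \<ge> N2 \<Longrightarrow> \<exists>\<alpha>. (\<forall>i. 0 \<le> \<alpha> i) \<and> (\<Sum>i<m. \<alpha> i) = (1::real) \<and> (\<Sum>i<m. \<alpha> i *\<^sub>R y i) = v"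
      using uv unfolding Q_def by blast
    have "\<exists>\<alpha>. (\<forall>i. 0 \<le> \<alpha> i) \<and> (\<Sum>i<m. \<alpha> i) = (1::real) \<and> (\<Sum>i<m. \<alpha> i *\<^sub>R y i) = s *\<^sub>R u + t *\<^sub>R v"
      if m: "m \<ge> max N1 N2" for m
    proof -
      obtain \<alpha> \<beta> where ab: "\<forall>i. 0 \<le> \<alpha> i" "(\<Sum>i<m. \<alpha> i) = (1::real)" "(\<Sum>i<m. \<alpha> i *\<^sub>R y i) = u"
         "\<forall>i. 0 \<le> \<beta> i" "(\<Sum>i<m. \<beta> i) = (1::real)" "(\<Sum>i<m. \<beta> i *\<^sub>R y i) = v"
        using N1[of m] N2[of m] m by auto
      show ?thesis
      proof (intro exI[of _ "\<lambda>i. s * \<alpha> i + t * \<beta> i"] conjI allI)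
        show "(\<Sum>i<m. s * \<alpha> i + t * \<beta> i) = 1"
          using ab st by (simp add: sum.distrib flip: sum_distrib_left)
        show "(\<Sum>i<m. (s * \<alpha> i + t * \<beta> i) *\<^sub>R y i) = s *\<^sub>R u + t *\<^sub>R v"
          by (simp add: scaleR_add_left sum.distrib ab(3,6)[symmetric] scaleR_sum_right)
      qed (use ab st in auto)
    qed
    then show "s *\<^sub>R u + t *\<^sub>R v \<in> Q" unfolding Q_def by blast
  qed
  ultimately show ?thesis using assms hull_minimal[of "range y" Q convex] unfolding Q_def by blast
qed

lemma closure_convex_hull_diameter:
  fixes Y :: "'b::real_normed_vector set"
  assumes Y: "\<And>x y. x \<in> Y \<Longrightarrow> y \<in> Y \<Longrightarrow> norm (x - y) \<le> c"
    and x: "x \<in> closure (convex hull Y)" and y: "y \<in> closure (convex hull Y)"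
  shows "norm (x - y) \<le> c"
proof -
  have hull: "closure (convex hull Y) \<subseteq> cball z c" if "Y \<subseteq> cball z c" for z
    using that by (simp add: closure_minimal hull_minimal)
  have "Y \<subseteq> cball x c"
  proof
    fix v assume v: "v \<in> Y"
    have "Y \<subseteq> cball v c" using Y v by (auto simp: dist_norm)
    then have "x \<in> cball v c" using hull x by blast
    then show "v \<in> cball x c" by (simp add: dist_commute)
  qed
  then have "y \<in> cball x c" using hull y by blast
  then show ?thesis by (simp add: dist_norm)
qed

lemma normal_structure_not_diametral_set:
  fixes V :: "'b::real_normed_vector set" and Y :: "'b set"
  assumes V: "normal_structure V" and Y: "Y \<subseteq> V" "Y \<noteq> {}" and c: "c > 0"
    and diam: "\<And>x y. x \<in> Y \<Longrightarrow> y \<in> Y \<Longrightarrow> norm (x - y) \<le> c"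
  shows "\<exists>x\<in>closure (convex hull Y). \<exists>c'<c. \<forall>y\<in>Y. norm (x - y) \<le> c'"
proof (cases "\<exists>a\<in>closure (convex hull Y). \<exists>b\<in>closure (convex hull Y). a \<noteq> b")
  case False
  obtain y where "y \<in> Y" using Y by auto
  moreover have "Y \<subseteq> closure (convex hull Y)" by (meson closure_subset hull_subset order_trans)
  ultimately have "\<forall>z\<in>Y. norm (y - z) \<le> 0" "y \<in> closure (convex hull Y)" using False by auto
  then show ?thesis using c by blast
next
  case True
  let ?F = "closure (convex hull Y)"
  have V': "closed V" "convex V" using V by (auto simp: normal_structure_def)
  have F: "?F \<noteq> {}" "closed ?F" "convex ?F" "?F \<subseteq> V"
    using Y V' by (auto simp: closure_minimal hull_minimal)
  obtain x where x: "x \<in> ?F" "Sup {norm (x - y) | y. y \<in> ?F} < Sup {norm (z - y) | y z. y \<in> ?F \<and> z \<in> ?F}"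
    using V[unfolded normal_structure_def] F True by blast
  have d: "norm (x - y) \<le> c" if "x \<in> ?F" "y \<in> ?F" for x y
    using closure_convex_hull_diameter[OF diam] that by blast
  have "Sup {norm (z - y) | y z. y \<in> ?F \<and> z \<in> ?F} \<le> c"
    by (rule cSup_least) (use x(1) d in auto)
  moreover have "norm (x - y) \<le> Sup {norm (x - y) | y. y \<in> ?F}" if "y \<in> Y" for y
  proof (rule cSup_upper)
    have "y \<in> ?F" using that by (meson closure_subset hull_subset subsetD)
    then show "norm (x - y) \<in> {norm (x - y) | y. y \<in> ?F}" by blast
    show "bdd_above {norm (x - y) | y. y \<in> ?F}" by (rule bdd_aboveI[of _ c]) (use x(1) d in auto)
  qed
  ultimately show ?thesis using x by (meson order_less_le_trans)
qed

text \<open>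
  Suppose \<open>c > 0\<close>. Any point \<open>z\<close> common to the closed convex hulls of the tails is within \<open>c\<close> of
  every \<open>y i\<close>, and the distance from \<open>y m\<close> to any given point of the hull is asymptotically at least
  \<open>c\<close>. The distances between terms may exceed \<open>c\<close> by an error, but moving \<open>y n\<close> towards \<open>z\<close> by the
  vanishing proportion \<open>e n / c\<close> removes the excess. A tail of the moved sequence has diameter at most \<open>c\<close>
  while every point of its closed convex hull has distances from it that come arbitrarily near \<open>c\<close>.
\<close>

lemma no_asymptotically_diametral_sequence:
  fixes V :: "'b::real_normed_vector set" and y :: "nat \<Rightarrow> 'b"
  assumes V: "normal_structure V"
    and compact: "\<And>C :: nat \<Rightarrow> 'b set. (\<And>n. closed (C n)) \<Longrightarrow> (\<And>n. convex (C n)) \<Longrightarrow> (\<And>n. C n \<noteq> {}) \<Longrightarrow>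
         (\<And>n. C n \<subseteq> V) \<Longrightarrow> decseq C \<Longrightarrow> (\<Inter>n. C n) \<noteq> {}"
    and y: "\<And>n. y n \<in> V"
    and e: "decseq e" "(\<lambda>m. real m * e m) \<longlonglongrightarrow> 0"
    and near: "eventually (\<lambda>m. \<forall>i<m. norm (y m - y i) \<le> c + e m) sequentially"
    and far: "eventually (\<lambda>m. norm (y m - (\<Sum>i<m. y i) /\<^sub>R real m) \<ge> c - e m) sequentially"
  shows "c \<le> 0"
proof (rule ccontr)
  assume "\<not> c \<le> 0"
  then have c: "c > 0" by simp
  have V': "closed V" "convex V" using V by (auto simp: normal_structure_def)
  have e_lim: "e \<longlonglongrightarrow> 0"
  proof (rule Lim_null_comparison)
    show "(\<lambda>m. \<bar>real m * e m\<bar>) \<longlonglongrightarrow> 0" using e(2) by (rule tendsto_rabs_zero)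
    show "eventually (\<lambda>m. norm (e m) \<le> \<bar>real m * e m\<bar>) sequentially"
      using eventually_ge_at_top[of 1]
      by eventually_elim (simp add: abs_mult mult_le_cancel_right1)
  qed
  have e0: "e n \<ge> 0" for n using decseq_ge[OF e(1) e_lim] .
  define K where "K n = closure (convex hull (y ` {n..}))" for n
  have K: "closed (K n)" "convex (K n)" "K n \<noteq> {}" "K n \<subseteq> V" for n
    unfolding K_def using y V' by (auto simp: closure_minimal hull_minimal image_subsetI)
  have "decseq K" unfolding K_def decseq_def
    by (intro allI impI closure_mono hull_mono image_mono) auto
  then have "(\<Inter>n. K n) \<noteq> {}" by (intro compact K)
  then obtain z where z: "\<And>n. z \<in> K n" by auto
  have zy: "norm (z - y i) \<le> c" for i
  proof (rule field_le_epsilon)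
    fix \<epsilon> :: real assume \<epsilon>: "\<epsilon> > 0"
    have "eventually (\<lambda>m. e m < \<epsilon>) sequentially" using e_lim \<epsilon> by (rule order_tendstoD)
    with near eventually_gt_at_top[of i]
    have "eventually (\<lambda>m. norm (y m - y i) \<le> c + \<epsilon>) sequentially"
      by eventually_elim force
    then obtain N where "\<And>m. m \<ge> N \<Longrightarrow> norm (y m - y i) \<le> c + \<epsilon>" by (auto simp: eventually_sequentially)
    then have "y ` {N..} \<subseteq> cball (y i) (c + \<epsilon>)" by (auto simp: dist_norm norm_minus_commute)
    then have "K N \<subseteq> cball (y i) (c + \<epsilon>)" unfolding K_def by (simp add: closure_minimal hull_minimal)
    then show "norm (z - y i) \<le> c + \<epsilon>" using z[of N] by (auto simp: dist_norm norm_minus_commute)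
  qed
  have lower: "eventually (\<lambda>m. norm (y m - x) \<ge> c - \<epsilon>) sequentially" if x: "x \<in> K 0" and \<epsilon>: "\<epsilon> > 0" for x \<epsilon>
  proof -
    obtain x' where x': "x' \<in> convex hull (range y)" "dist x' x < \<epsilon>/2"
      using x \<epsilon> unfolding K_def closure_approachable by (metis atLeast_0 half_gt_zero)
    obtain N where N: "\<And>m. m \<ge> N \<Longrightarrow> \<exists>\<alpha>. (\<forall>i. 0 \<le> \<alpha> i) \<and> (\<Sum>i<m. \<alpha> i) = (1::real) \<and> (\<Sum>i<m. \<alpha> i *\<^sub>R y i) = x'"
      using convex_hull_sequence_weights[OF x'(1)] by blast
    have "eventually (\<lambda>m. real m * e m < \<epsilon>/4) sequentially" using e(2) \<epsilon> by (intro order_tendstoD) auto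
    with near far eventually_ge_at_top[of N] eventually_gt_at_top[of 0] show ?thesis
    proof eventually_elim
      case (elim m)
      obtain \<alpha> where \<alpha>: "\<forall>i. 0 \<le> \<alpha> i" "(\<Sum>i<m. \<alpha> i) = (1::real)" "(\<Sum>i<m. \<alpha> i *\<^sub>R y i) = x'"
        using N elim by blast
      have "norm (y m - x') \<ge> c - 2 * real m * e m + e m"
        using weighted_sum_far[of m \<alpha> "y m" y c "e m"] \<alpha> elim by simp
      moreover have "norm (y m - x') \<le> norm (y m - x) + norm (x' - x)"
        using norm_triangle_ineq4[of "y m - x" "x' - x"] by simp
      ultimately show ?case using elim x'(2) e0[of m] by (simp add: dist_norm)
    qed
  qed
  \<comment> \<open>\<open>l n * c = e n\<close> is exactly the error that has to be compensated.\<close>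
  define l where "l n = e n / c" for n
  have l0: "l n \<ge> 0" for n using e0 c by (simp add: l_def)
  have l_mono: "l m \<le> l n" if "n \<le> m" for m n
    using decseqD[OF e(1) that] c by (simp add: l_def divide_right_mono)
  have l_lim: "l \<longlonglongrightarrow> 0" unfolding l_def using tendsto_divide[OF e_lim tendsto_const[of c]] c by simp
  then have "eventually (\<lambda>n. l n < 1) sequentially" by (rule order_tendstoD) simp
  with near have "eventually (\<lambda>m. (\<forall>i<m. norm (y m - y i) \<le> c + e m) \<and> l m < 1) sequentially"
    by eventually_elim simp
  then obtain N where N: "\<And>m i. m \<ge> N \<Longrightarrow> i < m \<Longrightarrow> norm (y m - y i) \<le> c + e m" "\<And>m. m \<ge> N \<Longrightarrow> l m < 1"
    by (auto simp: eventually_sequentially)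
  define w where "w n = (1 - l n) *\<^sub>R y n + l n *\<^sub>R z" for n
  have "y ` {0..} \<subseteq> K 0" unfolding K_def
    using closure_subset[of "convex hull (y ` {0..})"] hull_subset[of "y ` {0..}" convex] by blast
  then have yK: "y n \<in> K 0" for n by auto
  have wK: "w n \<in> K 0" if "n \<ge> N" for n
    unfolding w_def using convexD[OF K(2) yK z] N(2)[OF that] l0[of n] by simp
  have ww: "norm (w m - w n) \<le> c" if "N \<le> n" "n < m" for m n
  proof -
    \<comment> \<open>Since \<open>l\<close> decreases, this is a combination with nonnegative coefficients.\<close>
    have "w m - w n = (1 - l n) *\<^sub>R (y m - y n) + (l n - l m) *\<^sub>R (y m - z)"
      by (simp add: w_def algebra_simps)
    also have "norm \<dots> \<le> (1 - l n) * norm (y m - y n) + (l n - l m) * norm (y m - z)"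
      using N(2)[OF that(1)] l_mono[of n m] that by (intro order_trans[OF norm_triangle_ineq]) simp
    also have "\<dots> \<le> (1 - l n) * (c + e m) + (l n - l m) * c"
      using N that l_mono[of n m] zy[of m]
      by (intro add_mono mult_left_mono) (auto simp: norm_minus_commute less_imp_le)
    also have "\<dots> = c + e m - l m * c - l n * e m" by (simp add: algebra_simps)
    also have "\<dots> \<le> c" using mult_nonneg_nonneg[OF l0[of n] e0[of m]] c by (simp add: l_def)
    finally show ?thesis .
  qed
  define Y where "Y = w ` {N..}"
  have YK: "Y \<subseteq> K 0" using wK by (auto simp: Y_def)
  have "\<exists>x\<in>closure (convex hull Y). \<exists>c'<c. \<forall>y\<in>Y. norm (x - y) \<le> c'"
  proof (rule normal_structure_not_diametral_set[OF V _ _ c])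
    show "Y \<subseteq> V" using YK K(4) by blast
    show "Y \<noteq> {}" by (auto simp: Y_def)
    fix u v assume "u \<in> Y" "v \<in> Y"
    then obtain m n where "u = w m" "v = w n" "m \<ge> N" "n \<ge> N" by (auto simp: Y_def)
    then show "norm (u - v) \<le> c"
      using ww[of m n] ww[of n m] c by (cases m n rule: linorder_cases) (auto simp: norm_minus_commute)
  qed
  then obtain x c' where x: "x \<in> closure (convex hull Y)" "c' < c" "\<And>v. v \<in> Y \<Longrightarrow> norm (x - v) \<le> c'" by blast
  have "closure (convex hull Y) \<subseteq> K 0"
    by (intro closure_minimal hull_minimal[where S = convex] YK K)
  then have "x \<in> K 0" using x(1) by blast
  define \<epsilon> where "\<epsilon> = (c - c') / 3"
  have \<epsilon>: "\<epsilon> > 0" using x by (simp add: \<epsilon>_def)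
  have "(\<lambda>n. l n * c) \<longlonglongrightarrow> 0" using tendsto_mult[OF l_lim tendsto_const[of c]] by simp
  then have "eventually (\<lambda>m. l m * c < \<epsilon>) sequentially" using \<epsilon> by (rule order_tendstoD)
  with lower[OF \<open>x \<in> K 0\<close> \<epsilon>] eventually_ge_at_top[of N] have "eventually (\<lambda>m. False) sequentially"
  proof eventually_elim
    case (elim m)
    have "y m - x = (y m - w m) - (x - w m)" by simp
    then have "norm (y m - x) \<le> norm (y m - w m) + norm (x - w m)" by (metis norm_triangle_ineq4)
    moreover have "y m - w m = l m *\<^sub>R (y m - z)" by (simp add: w_def algebra_simps)
    then have "norm (y m - w m) \<le> l m * c"
      using zy[of m] l0[of m] by (simp add: mult_left_mono norm_minus_commute)
    moreover have "norm (x - w m) \<le> c'" using x elim by (simp add: Y_def)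
    ultimately have "c - \<epsilon> \<le> \<epsilon> + c'" using elim by linarith
    then show ?case using \<epsilon> by (simp add: \<epsilon>_def field_simps)
  qed
  then show False by simp
qed

text \<open>
  The same obstruction with the limiting radius produced from the sequence itself: the
  distances \<open>a m\<close> to the averages form a Cauchy sequence, and their limit plays the role of \<open>c\<close>.
\<close>

lemma radii_tend_to_zero:
  fixes V :: "'b::real_normed_vector set" and y :: "nat \<Rightarrow> 'b"
  assumes V: "normal_structure V"
    and compact: "\<And>C :: nat \<Rightarrow> 'b set. (\<And>n. closed (C n)) \<Longrightarrow> (\<And>n. convex (C n)) \<Longrightarrow> (\<And>n. C n \<noteq> {}) \<Longrightarrow>
         (\<And>n. C n \<subseteq> V) \<Longrightarrow> decseq C \<Longrightarrow> (\<Inter>n. C n) \<noteq> {}"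
    and y: "\<And>n. y n \<in> V"
  defines "a \<equiv> \<lambda>m. norm (y m - (\<Sum>i<m. y i) /\<^sub>R real m)"
  assumes near: "eventually (\<lambda>m. \<forall>i<m. norm (y m - y i) \<le> a m + (1/2)^m) sequentially"
    and step: "eventually (\<lambda>m. \<bar>a m - a (Suc m)\<bar> \<le> (1/2)^m) sequentially"
  shows "a \<longlonglongrightarrow> 0"
proof -
  obtain N where N: "\<And>m. m \<ge> N \<Longrightarrow> \<bar>a m - a (Suc m)\<bar> \<le> (1/2)^m"
    using step by (auto simp: eventually_sequentially)
  have step': "\<bar>a m - a (m + k)\<bar> \<le> 2 * (1/2)^m - 2 * (1/2)^(m+k)" if "m \<ge> N" for m k
  proof (induction k)
    case (Suc k)
    then show ?case using N[of "m + k"] that by simp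
  qed simp
  have st: "\<bar>a m - a n\<bar> \<le> 2 * (1/2)^m" if "m \<ge> N" "n \<ge> m" for m n
  proof -
    have "0 \<le> (1/2::real)^n" by simp
    then show ?thesis using step'[OF that(1), of "n - m"] that(2) by (simp del: zero_le_power)
  qed
  have pow: "(\<lambda>m. 2 * (1/2)^m :: real) \<longlonglongrightarrow> 0"
    using tendsto_mult_right_zero[OF LIMSEQ_power_zero[of "1/2::real"], of 2] by simp
  have "Cauchy a"
  proof (rule metric_CauchyI)
    fix \<epsilon> :: real assume "\<epsilon> > 0"
    then have "eventually (\<lambda>m. 2 * (1/2)^m < \<epsilon>/2) sequentially" by (intro order_tendstoD(2)[OF pow]) simp
    then obtain M where M: "\<And>m. m \<ge> M \<Longrightarrow> 2 * (1/2)^m < \<epsilon>/2" by (auto simp: eventually_sequentially)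
    show "\<exists>M. \<forall>m\<ge>M. \<forall>n\<ge>M. dist (a m) (a n) < \<epsilon>"
    proof (intro exI[of _ "max M N"] allI impI)
      fix m n assume "m \<ge> max M N" "n \<ge> max M N"
      then show "dist (a m) (a n) < \<epsilon>"
        using st[of "max M N" m] st[of "max M N" n] M[of "max M N"] by (simp add: dist_real_def)
    qed
  qed
  then obtain c where c: "a \<longlonglongrightarrow> c" by (auto simp: Cauchy_convergent_iff convergent_def)
  have ac: "\<bar>a m - c\<bar> \<le> 2 * (1/2)^m" if "m \<ge> N" for m
  proof (rule tendsto_upperbound)
    show "(\<lambda>n. \<bar>a m - a n\<bar>) \<longlonglongrightarrow> \<bar>a m - c\<bar>" by (intro tendsto_intros c)
    show "eventually (\<lambda>n. \<bar>a m - a n\<bar> \<le> 2 * (1/2)^m) sequentially"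
      using eventually_ge_at_top[of m] by eventually_elim (use st that in auto)
  qed simp
  have "c \<le> 0"
  proof (rule no_asymptotically_diametral_sequence[OF V compact y])
    show "decseq (\<lambda>m. 3 * (1/2)^m :: real)" by (rule decseq_SucI) simp
    show "(\<lambda>m. real m * (3 * (1/2)^m)) \<longlonglongrightarrow> 0" by real_asymp
    show "eventually (\<lambda>m. \<forall>i<m. norm (y m - y i) \<le> c + 3 * (1/2)^m) sequentially"
      using near eventually_ge_at_top[of N]
    proof eventually_elim
      case (elim m)
      show ?case
      proof (intro allI impI)
        fix i assume "i < m"
        then show "norm (y m - y i) \<le> c + 3 * (1/2)^m" using elim ac[of m] by force
      qed
    qed
    show "eventually (\<lambda>m. norm (y m - (\<Sum>i<m. y i) /\<^sub>R real m) \<ge> c - 3 * (1/2)^m) sequentially"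
      using eventually_ge_at_top[of N]
    proof eventually_elim
      case (elim m)
      have "0 \<le> (1/2::real)^m" by simp
      then have "c - 3 * (1/2)^m \<le> a m" using ac[OF elim] by linarith
      then show ?case by (simp add: a_def)
    qed
  qed
  moreover have "c \<ge> 0" by (rule LIMSEQ_le_const[OF c]) (auto simp: a_def)
  ultimately show ?thesis using c by simp
qed

section \<open>Strong random elements\<close>

lemma simple_random_element_iff:
  "simple_random_element P S X \<longleftrightarrow> simple_function P X \<and> X \<in> space P \<rightarrow> S"
proof
  assume X: "simple_random_element P S X"
  have "X -` {X \<omega>} \<inter> space P \<in> sets P" if "\<omega> \<in> space P" for \<omega>
  proof -
    have "openin (top_of_set S) (S - {X \<omega>})" by (auto simp: openin_open)
    then have "X -` (S - {X \<omega>}) \<inter> space P \<in> sets P"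
      using X by (simp add: simple_random_element_def random_element_def)
    then have "space P - (X -` (S - {X \<omega>}) \<inter> space P) \<in> sets P" by (rule sets.compl_sets)
    also have "space P - (X -` (S - {X \<omega>}) \<inter> space P) = X -` {X \<omega>} \<inter> space P"
      using X by (auto simp: simple_random_element_def random_element_def)
    finally show ?thesis .
  qed
  then show "simple_function P X \<and> X \<in> space P \<rightarrow> S"
    using X by (auto simp: simple_random_element_def random_element_def simple_function_def)
next
  assume "simple_function P X \<and> X \<in> space P \<rightarrow> S"
  then show "simple_random_element P S X"
    by (auto simp: simple_random_element_def random_element_def simple_functionD)
qed

lemma strong_random_element_iff:
  "strong_random_element P S X \<longleftrightarrow> X \<in> space P \<rightarrow> S \<and>
     (\<exists>Xs. (\<forall>n. simple_function P (Xs n) \<and> Xs n \<in> space P \<rightarrow> S) \<and>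
        (\<forall>\<omega>\<in>space P. (\<lambda>n. Xs n \<omega>) \<longlonglongrightarrow> X \<omega>))"
  by (simp add: strong_random_element_def simple_random_element_iff)

lemma strong_random_elementI:
  assumes "\<And>n. simple_function P (Xs n)" "\<And>n \<omega>. \<omega> \<in> space P \<Longrightarrow> Xs n \<omega> \<in> S"
    and "\<And>\<omega>. \<omega> \<in> space P \<Longrightarrow> (\<lambda>n. Xs n \<omega>) \<longlonglongrightarrow> X \<omega>"
    and "\<And>\<omega>. \<omega> \<in> space P \<Longrightarrow> X \<omega> \<in> S"
  shows "strong_random_element P S X"
  unfolding strong_random_element_iff using assms by (intro conjI exI[of _ Xs]) auto

lemma strong_random_element_in: "strong_random_element P S X \<Longrightarrow> \<omega> \<in> space P \<Longrightarrow> X \<omega> \<in> S"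
  by (auto simp: strong_random_element_def)

lemma strong_random_element_simple:
  "simple_function P X \<Longrightarrow> X \<in> space P \<rightarrow> S \<Longrightarrow> strong_random_element P S X"
  unfolding strong_random_element_iff by (intro conjI exI[of _ "\<lambda>n. X"]) auto

lemma strong_random_element_const: "c \<in> S \<Longrightarrow> strong_random_element P S (\<lambda>\<omega>. c)"
  by (rule strong_random_element_simple) auto

lemma strong_random_element_combine:
  fixes X :: "'w \<Rightarrow> 'a::metric_space" and Y :: "'w \<Rightarrow> 'b::metric_space" and h :: "'a \<Rightarrow> 'b \<Rightarrow> 'c::metric_space"
  assumes X: "strong_random_element P S X" and Y: "strong_random_element P S' Y"
    and h: "\<And>x y. x \<in> S \<Longrightarrow> y \<in> S' \<Longrightarrow> h x y \<in> S''"
    and cont: "continuous_on UNIV (\<lambda>(x, y). h x y)"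
  shows "strong_random_element P S'' (\<lambda>\<omega>. h (X \<omega>) (Y \<omega>))"
proof -
  obtain Xs where Xs: "\<And>n. simple_function P (Xs n)" "\<And>n. Xs n \<in> space P \<rightarrow> S"
     "\<And>\<omega>. \<omega> \<in> space P \<Longrightarrow> (\<lambda>n. Xs n \<omega>) \<longlonglongrightarrow> X \<omega>"
    using X unfolding strong_random_element_iff by blast
  obtain Ys where Ys: "\<And>n. simple_function P (Ys n)" "\<And>n. Ys n \<in> space P \<rightarrow> S'"
     "\<And>\<omega>. \<omega> \<in> space P \<Longrightarrow> (\<lambda>n. Ys n \<omega>) \<longlonglongrightarrow> Y \<omega>"
    using Y unfolding strong_random_element_iff by blast
  have "(\<lambda>n. h (Xs n \<omega>) (Ys n \<omega>)) \<longlonglongrightarrow> h (X \<omega>) (Y \<omega>)" if "\<omega> \<in> space P" for \<omega>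
    using continuous_on_tendsto_compose[OF cont tendsto_Pair[OF Xs(3)[OF that] Ys(3)[OF that]]] by simp
  then show ?thesis
  proof (rule strong_random_elementI[where Xs = "\<lambda>n \<omega>. h (Xs n \<omega>) (Ys n \<omega>)", rotated 2])
    show "simple_function P (\<lambda>\<omega>. h (Xs n \<omega>) (Ys n \<omega>))" for n
      by (rule simple_function_compose2[OF Xs(1) Ys(1)])
    fix \<omega> assume \<omega>: "\<omega> \<in> space P"
    show "h (X \<omega>) (Y \<omega>) \<in> S''"
      by (intro h strong_random_element_in[OF X \<omega>] strong_random_element_in[OF Y \<omega>])
    show "h (Xs n \<omega>) (Ys n \<omega>) \<in> S''" for n
      using Xs(2)[of n] Ys(2)[of n] \<omega> by (intro h) auto
  qed
qed

lemma strong_random_element_real_measurable: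
  fixes X :: "'w \<Rightarrow> real"
  assumes "strong_random_element P S X"
  shows "X \<in> borel_measurable P"
proof -
  obtain Xs where "\<And>n. simple_function P (Xs n)" "\<And>\<omega>. \<omega> \<in> space P \<Longrightarrow> (\<lambda>n. Xs n \<omega>) \<longlonglongrightarrow> X \<omega>"
    using assms unfolding strong_random_element_iff by blast
  then show ?thesis by (intro borel_measurable_LIMSEQ_real[of P Xs X]) (auto intro: borel_measurable_simple_function)
qed

lemma strong_random_element_dist_measurable:
  assumes "strong_random_element P S X" "strong_random_element P S' Y"
  shows "(\<lambda>\<omega>. dist (X \<omega>) (Y \<omega>)) \<in> borel_measurable P"
  by (rule strong_random_element_real_measurable[OF strong_random_element_combine[OF assms, where S'' = UNIV]])
     (auto simp: case_prod_unfold intro!: continuous_intros)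

lemma strong_random_element_glue:
  assumes "strong_random_element P S X" "strong_random_element P S Y" "A \<in> sets P"
  shows "strong_random_element P S (\<lambda>\<omega>. if \<omega> \<in> A then X \<omega> else Y \<omega>)"
proof -
  obtain Xs where Xs: "\<And>n. simple_function P (Xs n)" "\<And>n. Xs n \<in> space P \<rightarrow> S"
     "\<And>\<omega>. \<omega> \<in> space P \<Longrightarrow> (\<lambda>n. Xs n \<omega>) \<longlonglongrightarrow> X \<omega>"
    using assms unfolding strong_random_element_iff by blast
  obtain Ys where Ys: "\<And>n. simple_function P (Ys n)" "\<And>n. Ys n \<in> space P \<rightarrow> S"
     "\<And>\<omega>. \<omega> \<in> space P \<Longrightarrow> (\<lambda>n. Ys n \<omega>) \<longlonglongrightarrow> Y \<omega>"
    using assms unfolding strong_random_element_iff by blast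
  have "simple_function P (\<lambda>\<omega>. if \<omega> \<in> A then Xs n \<omega> else Ys n \<omega>)" for n
    by (rule simple_function_If_set[OF Xs(1) Ys(1)]) (use assms(3) in auto)
  then show ?thesis
  proof (rule strong_random_elementI[where Xs = "\<lambda>n \<omega>. if \<omega> \<in> A then Xs n \<omega> else Ys n \<omega>"])
    fix \<omega> assume \<omega>: "\<omega> \<in> space P"
    show "(\<lambda>n. if \<omega> \<in> A then Xs n \<omega> else Ys n \<omega>) \<longlonglongrightarrow> (if \<omega> \<in> A then X \<omega> else Y \<omega>)"
      using Xs(3)[OF \<omega>] Ys(3)[OF \<omega>] by simp
    show "(if \<omega> \<in> A then X \<omega> else Y \<omega>) \<in> S"
      using strong_random_element_in[OF assms(1) \<omega>] strong_random_element_in[OF assms(2) \<omega>] by simp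
    show "(if \<omega> \<in> A then Xs n \<omega> else Ys n \<omega>) \<in> S" for n
      using Xs(2)[of n] Ys(2)[of n] \<omega> by auto
  qed
qed

text \<open>
  The nearest of \<open>v 0, \<dots>, v n\<close> to \<open>f\<close> at each point of \<open>\<Omega>\<close>, written as an iterated
  gluing along sets.
\<close>

primrec best_approximant :: "'w set \<Rightarrow> ('w \<Rightarrow> 'a::metric_space) \<Rightarrow> (nat \<Rightarrow> 'w \<Rightarrow> 'a) \<Rightarrow> nat \<Rightarrow> 'w \<Rightarrow> 'a" where
  "best_approximant \<Omega> f v 0 = v 0"
| "best_approximant \<Omega> f v (Suc n) =
    (\<lambda>\<omega>. if \<omega> \<in> {\<omega>\<in>\<Omega>. dist (f \<omega>) (v (Suc n) \<omega>) < dist (f \<omega>) (best_approximant \<Omega> f v n \<omega>)}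
      then v (Suc n) \<omega> else best_approximant \<Omega> f v n \<omega>)"

lemma best_approximant_le:
  assumes "\<omega> \<in> \<Omega>" "i \<le> n"
  shows "dist (f \<omega>) (best_approximant \<Omega> f v n \<omega>) \<le> dist (f \<omega>) (v i \<omega>)"
  using assms(2)
proof (induction n)
  case (Suc n)
  then show ?case using assms(1) by (cases "i = Suc n") (auto simp: not_less le_Suc_eq)
qed simp

lemma best_approximant_tendsto:
  assumes "\<omega> \<in> \<Omega>" "f \<omega> \<in> closure (range (\<lambda>n. v n \<omega>))"
  shows "(\<lambda>n. best_approximant \<Omega> f v n \<omega>) \<longlonglongrightarrow> f \<omega>"
proof (rule metric_LIMSEQ_I)
  fix \<epsilon> :: real assume "\<epsilon> > 0"
  then obtain i where i: "dist (v i \<omega>) (f \<omega>) < \<epsilon>"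
    using assms(2) unfolding closure_approachable by blast
  show "\<exists>N. \<forall>n\<ge>N. dist (best_approximant \<Omega> f v n \<omega>) (f \<omega>) < \<epsilon>"
  proof (intro exI[of _ i] allI impI)
    fix n assume "n \<ge> i"
    then show "dist (best_approximant \<Omega> f v n \<omega>) (f \<omega>) < \<epsilon>"
      using best_approximant_le[OF assms(1), of i n f v] i by (simp add: dist_commute)
  qed
qed

text \<open>
  Approximants with values switched on measurable sets stay in any class that is closed under
  gluing. With simple functions as the class this gives strong measurability, with an admissible set as
  the class it gives membership.
\<close>

lemma best_approximant_in:
  assumes v: "\<And>n. v n \<in> G"
    and glue: "\<And>A g h. A \<in> sets P \<Longrightarrow> g \<in> G \<Longrightarrow> h \<in> G \<Longrightarrow> (\<lambda>\<omega>. if \<omega> \<in> A then g \<omega> else h \<omega>) \<in> G"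
    and meas: "\<And>g. g \<in> G \<Longrightarrow> (\<lambda>\<omega>. dist (f \<omega>) (g \<omega>)) \<in> borel_measurable P"
  shows "best_approximant (space P) f v n \<in> G"
proof (induction n)
  case (Suc n)
  have "{\<omega>\<in>space P. dist (f \<omega>) (v (Suc n) \<omega>) < dist (f \<omega>) (best_approximant (space P) f v n \<omega>)} \<in> sets P"
    by (rule borel_measurable_less[OF meas[OF v] meas[OF Suc.IH]])
  then show ?case unfolding best_approximant.simps by (rule glue[OF _ v Suc.IH])
qed (simp add: v)

text \<open>
  The values of all simple approximants of all \<open>f n\<close> form a countable set whose closure contains
  the values of \<open>X\<close>; the best approximants from this set are simple and converge to \<open>X\<close>.
\<close>

lemma strong_random_element_limit:
  fixes f :: "nat \<Rightarrow> 'w \<Rightarrow> 'a::metric_space"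
  assumes f: "\<And>n. strong_random_element P S (f n)" and S: "closed S"
    and lim: "\<And>\<omega>. \<omega> \<in> space P \<Longrightarrow> (\<lambda>n. f n \<omega>) \<longlonglongrightarrow> X \<omega>"
  shows "strong_random_element P S X"
proof (cases "space P = {}")
  case True
  then have "simple_function P X" by (simp add: simple_function_def)
  then show ?thesis using True by (intro strong_random_element_simple) auto
next
  case False
  have XS: "X \<omega> \<in> S" if "\<omega> \<in> space P" for \<omega>
    using closed_sequentially[OF S _ lim[OF that]] strong_random_element_in[OF f that] by blast
  have "\<forall>n. \<exists>F. (\<forall>k. simple_function P (F k) \<and> F k \<in> space P \<rightarrow> S) \<and> (\<forall>\<omega>\<in>space P. (\<lambda>k. F k \<omega>) \<longlonglongrightarrow> f n \<omega>)"
    using f unfolding strong_random_element_iff by blast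
  then obtain F where F: "\<And>n k. simple_function P (F n k)" "\<And>n k. F n k \<in> space P \<rightarrow> S"
    "\<And>n \<omega>. \<omega> \<in> space P \<Longrightarrow> (\<lambda>k. F n k \<omega>) \<longlonglongrightarrow> f n \<omega>" by metis
  define Q where "Q = (\<Union>n k. F n k ` space P)"
  have "countable Q" unfolding Q_def
    by (intro countable_UN countableI_type countable_finite simple_functionD(1)[OF F(1)])
  moreover have "Q \<noteq> {}" using False by (auto simp: Q_def)
  moreover have "Q \<subseteq> S" using F(2) unfolding Q_def by blast
  ultimately have Q: "countable Q" "Q \<noteq> {}" "Q \<subseteq> S" .
  define v where "v n = (\<lambda>\<omega>::'w. from_nat_into Q n)" for n
  have v_range: "range (\<lambda>n. v n \<omega>) = Q" for \<omega>
    unfolding v_def using range_from_nat_into[OF Q(2,1)] .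
  have dist_f: "(\<lambda>\<omega>. dist (X \<omega>) (g \<omega>)) \<in> borel_measurable P" if g: "simple_function P g" for g
  proof (rule borel_measurable_LIMSEQ_real)
    show "(\<lambda>\<omega>. dist (f n \<omega>) (g \<omega>)) \<in> borel_measurable P" for n
      using strong_random_element_dist_measurable[OF f strong_random_element_simple[OF g, of UNIV]] by simp
    show "(\<lambda>n. dist (f n \<omega>) (g \<omega>)) \<longlonglongrightarrow> dist (X \<omega>) (g \<omega>)" if "\<omega> \<in> space P" for \<omega>
      by (intro tendsto_intros lim that)
  qed
  have "X \<omega> \<in> closure Q" if \<omega>: "\<omega> \<in> space P" for \<omega>
  proof (rule closed_sequentially[OF closed_closure _ lim[OF \<omega>]])
    fix n
    show "f n \<omega> \<in> closure Q"
    proof (rule closed_sequentially[OF closed_closure _ F(3)[OF \<omega>]])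
      fix k show "F n k \<omega> \<in> closure Q" using \<omega> closure_subset by (fastforce simp: Q_def)
    qed
  qed
  then have "(\<lambda>n. best_approximant (space P) X v n \<omega>) \<longlonglongrightarrow> X \<omega>" if "\<omega> \<in> space P" for \<omega>
    using that by (intro best_approximant_tendsto) (auto simp: v_range)
  moreover have "best_approximant (space P) X v n \<in> {g. simple_function P g \<and> g \<in> space P \<rightarrow> S}" for n
  proof (rule best_approximant_in)
    show "v n \<in> {g. simple_function P g \<and> g \<in> space P \<rightarrow> S}" for n
      using v_range[of undefined] Q(3) by (auto simp: v_def)
  qed (auto intro!: simple_function_If_set dist_f simp: Pi_iff)
  ultimately show ?thesis
    by (intro strong_random_elementI[where Xs = "best_approximant (space P) X v"] XS) auto
qed

text \<open>
  For simple \<open>X\<close> only finitely many of the strong random elements \<open>T(\<cdot>, x)\<close> are pieced together;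
  nonexpansiveness carries the result over to limits.
\<close>

lemma strong_random_operator_apply:
  fixes T :: "'w \<Rightarrow> 'a::metric_space \<Rightarrow> 'c::metric_space"
  assumes T: "strong_random_nonexpansive_operator P S S' T" and S': "closed S'"
    and X: "strong_random_element P S X"
  shows "strong_random_element P S' (\<lambda>\<omega>. T \<omega> (X \<omega>))"
proof -
  have T1: "strong_random_element P S' (\<lambda>\<omega>. T \<omega> x)" if "x \<in> S" for x
    using T that by (simp add: strong_random_nonexpansive_operator_def strong_random_operator_def)
  have T2: "dist (T \<omega> x) (T \<omega> y) \<le> dist x y" if "\<omega> \<in> space P" "x \<in> S" "y \<in> S" for \<omega> x y
    using T that by (simp add: strong_random_nonexpansive_operator_def random_nonexpansive_def)
  have simple: "strong_random_element P S' (\<lambda>\<omega>. T \<omega> (F \<omega>))"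
    if F: "simple_function P F" "F \<in> space P \<rightarrow> S" for F
  proof -
    have "\<forall>x\<in>S. \<exists>G. (\<forall>n. simple_function P (G n) \<and> G n \<in> space P \<rightarrow> S') \<and> (\<forall>\<omega>\<in>space P. (\<lambda>n. G n \<omega>) \<longlonglongrightarrow> T \<omega> x)"
    proof
      fix x assume "x \<in> S"
      from T1[OF this, unfolded strong_random_element_iff, THEN conjunct2]
      show "\<exists>G. (\<forall>n. simple_function P (G n) \<and> G n \<in> space P \<rightarrow> S') \<and> (\<forall>\<omega>\<in>space P. (\<lambda>n. G n \<omega>) \<longlonglongrightarrow> T \<omega> x)" .
    qed
    from bchoice[OF this] obtain G where G: "\<forall>x\<in>S. (\<forall>n. simple_function P (G x n) \<and> G x n \<in> space P \<rightarrow> S') \<and>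
        (\<forall>\<omega>\<in>space P. (\<lambda>n. G x n \<omega>) \<longlonglongrightarrow> T \<omega> x)" ..
    have FS: "F \<omega> \<in> S" if "\<omega> \<in> space P" for \<omega> using F(2) that by blast
    have sim: "simple_function P (\<lambda>\<omega>. G (F \<omega>) n \<omega>)" for n
    proof (subst simple_function_def, intro conjI ballI)
      have fin: "finite (F ` space P)" using F(1) by (simp add: simple_function_def)
      have "(\<lambda>\<omega>. G (F \<omega>) n \<omega>) ` space P \<subseteq> (\<Union>x\<in>F ` space P. G x n ` space P)" by auto
      moreover have "finite (\<Union>x\<in>F ` space P. G x n ` space P)"
      proof (rule finite_UN_I[OF fin])
        fix x assume "x \<in> F ` space P"
        then have "x \<in> S" using FS by blast
        then have "simple_function P (G x n)" using G[THEN bspec] by simp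
        then show "finite (G x n ` space P)" by (rule simple_functionD(1))
      qed
      ultimately show "finite ((\<lambda>\<omega>. G (F \<omega>) n \<omega>) ` space P)" by (rule finite_subset)
      fix c
      have "(\<lambda>\<omega>. G (F \<omega>) n \<omega>) -` {c} \<inter> space P =
          (\<Union>x\<in>F ` space P. (F -` {x} \<inter> space P) \<inter> (G x n -` {c} \<inter> space P))" by auto
      also have "\<dots> \<in> sets P"
      proof (rule sets.finite_UN[OF fin])
        fix x assume "x \<in> F ` space P"
        then have "x \<in> S" using FS by blast
        then have "simple_function P (G x n)" using G[THEN bspec] by simp
        then show "(F -` {x} \<inter> space P) \<inter> (G x n -` {c} \<inter> space P) \<in> sets P"
          by (intro sets.Int simple_functionD(2) F(1))
      qed
      finally show "(\<lambda>\<omega>. G (F \<omega>) n \<omega>) -` {c} \<inter> space P \<in> sets P" .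
    qed
    have inS: "G (F \<omega>) n \<omega> \<in> S'" if "\<omega> \<in> space P" for n \<omega>
      using G[THEN bspec, OF FS[OF that]] that by blast
    have lim: "(\<lambda>n. G (F \<omega>) n \<omega>) \<longlonglongrightarrow> T \<omega> (F \<omega>)" if "\<omega> \<in> space P" for \<omega>
      using G[THEN bspec, OF FS[OF that]] that by blast
    show ?thesis
    proof (rule strong_random_elementI[where Xs = "\<lambda>n \<omega>. G (F \<omega>) n \<omega>", OF sim])
      fix \<omega> assume \<omega>: "\<omega> \<in> space P"
      show "T \<omega> (F \<omega>) \<in> S'" using strong_random_element_in[OF T1[OF FS[OF \<omega>]] \<omega>] .
    qed (use inS lim in auto)
  qed
  obtain F where F: "\<And>n. simple_function P (F n)" "\<And>n. F n \<in> space P \<rightarrow> S"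
     "\<And>\<omega>. \<omega> \<in> space P \<Longrightarrow> (\<lambda>n. F n \<omega>) \<longlonglongrightarrow> X \<omega>"
    using X unfolding strong_random_element_iff by blast
  show ?thesis
  proof (rule strong_random_element_limit[OF simple[OF F(1,2)] S'])
    fix \<omega> assume \<omega>: "\<omega> \<in> space P"
    have "(\<lambda>n. dist (F n \<omega>) (X \<omega>)) \<longlonglongrightarrow> 0"
      by (rule iffD1[OF tendsto_dist_iff F(3)[OF \<omega>]])
    moreover have "dist (T \<omega> (F n \<omega>)) (T \<omega> (X \<omega>)) \<le> dist (F n \<omega>) (X \<omega>)" for n
    proof (rule T2[OF \<omega> _ strong_random_element_in[OF X \<omega>]])
      show "F n \<omega> \<in> S" using F(2)[of n] \<omega> by blast
    qed
    then have "eventually (\<lambda>n. norm (dist (T \<omega> (F n \<omega>)) (T \<omega> (X \<omega>))) \<le> dist (F n \<omega>) (X \<omega>)) sequentially"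
      by simp
    ultimately have "(\<lambda>n. dist (T \<omega> (F n \<omega>)) (T \<omega> (X \<omega>))) \<longlonglongrightarrow> 0"
      by (rule Lim_null_comparison[rotated])
    then show "(\<lambda>n. T \<omega> (F n \<omega>)) \<longlonglongrightarrow> T \<omega> (X \<omega>)" by (rule iffD2[OF tendsto_dist_iff])
  qed
qed

section \<open>Measurable selections from closed convex tails\<close>

text \<open>
  Mixtures with rational weights form a countable type, and their closure is already convex. Mixing
  functions rather than their values gives countably many strong random elements that are dense in the
  closed convex hull for every \<open>\<omega>\<close> simultaneously.
\<close>

datatype mixture = Leaf nat | Mix rat mixture mixture

instance mixture :: countable
  by countable_datatype

text \<open>
  Clamping to the unit interval allows every rational label.
\<close>

definition weight :: "rat \<Rightarrow> real" where
  "weight q = max 0 (min 1 (of_rat q))"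

primrec mix :: "(nat \<Rightarrow> 'w \<Rightarrow> 'b::real_vector) \<Rightarrow> mixture \<Rightarrow> 'w \<Rightarrow> 'b" where
  "mix f (Leaf k) = f k"
| "mix f (Mix q s t) = (\<lambda>\<omega>. (1 - weight q) *\<^sub>R mix f s \<omega> + weight q *\<^sub>R mix f t \<omega>)"

primrec leaves :: "mixture \<Rightarrow> nat set" where
  "leaves (Leaf k) = {k}"
| "leaves (Mix q s t) = leaves s \<union> leaves t"

lemma weight_bounds: "0 \<le> weight q" "weight q \<le> 1"
  by (auto simp: weight_def)

lemma convex_closure_rational:
  fixes S :: "'b::real_normed_vector set"
  assumes S: "\<And>x y q. x \<in> S \<Longrightarrow> y \<in> S \<Longrightarrow> (1 - weight q) *\<^sub>R x + weight q *\<^sub>R y \<in> S"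
  shows "convex (closure S)"
  unfolding convex_alt
proof (intro ballI allI impI)
  fix x y and t :: real assume xy: "x \<in> closure S" "y \<in> closure S" and t: "0 \<le> t \<and> t \<le> 1"
  obtain X where X: "\<And>n. X n \<in> S" "X \<longlonglongrightarrow> x" using xy unfolding closure_sequential by blast
  obtain Y where Y: "\<And>n. Y n \<in> S" "Y \<longlonglongrightarrow> y" using xy unfolding closure_sequential by blast
  have "\<exists>q. t < of_rat q \<and> of_rat q < t + 1 / real (Suc n)" for n
    by (rule of_rat_dense) simp
  then obtain q where q: "\<And>n. t < of_rat (q n)" "\<And>n. of_rat (q n) < t + 1 / real (Suc n)" by metis
  have "(\<lambda>n. of_rat (q n)) \<longlonglongrightarrow> t"
  proof (rule tendsto_sandwich[of "\<lambda>_. t" _ _ "\<lambda>n. t + 1 / real (Suc n)"])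
    show "(\<lambda>n. t + 1 / real (Suc n)) \<longlonglongrightarrow> t"
      using tendsto_add[OF tendsto_const[of t] LIMSEQ_Suc[OF lim_1_over_n]] by simp
  qed (use q in \<open>auto simp: less_imp_le intro!: always_eventually\<close>)
  then have "(\<lambda>n. weight (q n)) \<longlonglongrightarrow> max 0 (min 1 t)"
    unfolding weight_def by (intro tendsto_intros)
  then have "(\<lambda>n. weight (q n)) \<longlonglongrightarrow> t" using t by simp
  then have "(\<lambda>n. (1 - weight (q n)) *\<^sub>R X n + weight (q n) *\<^sub>R Y n) \<longlonglongrightarrow> (1 - t) *\<^sub>R x + t *\<^sub>R y"
    by (intro tendsto_intros X Y)
  then show "(1 - t) *\<^sub>R x + t *\<^sub>R y \<in> closure S"
    unfolding closure_sequential
    by (intro exI[of _ "\<lambda>n. (1 - weight (q n)) *\<^sub>R X n + weight (q n) *\<^sub>R Y n"]) (simp add: S X(1) Y(1))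
qed

locale random_convex_set = prob_space P for P :: "'w measure" +
  fixes V :: "'b::banach set"
  assumes closed_V: "closed V" and convex_V: "convex V" and bounded_V: "bounded V" and V_nonempty: "V \<noteq> {}"
    and decseq_Inter: "\<And>C :: nat \<Rightarrow> 'b set. (\<And>n. closed (C n)) \<Longrightarrow> (\<And>n. convex (C n)) \<Longrightarrow>
      (\<And>n. C n \<noteq> {}) \<Longrightarrow> (\<And>n. C n \<subseteq> V) \<Longrightarrow> decseq C \<Longrightarrow> (\<Inter>n. C n) \<noteq> {}"
begin

abbreviation E :: "('w \<Rightarrow> 'b) \<Rightarrow> bool" where
  "E \<equiv> strong_random_element P V"

lemma E_mix:
  assumes "E f" "E g" "0 \<le> t" "t \<le> 1"
  shows "E (\<lambda>\<omega>. (1 - t) *\<^sub>R f \<omega> + t *\<^sub>R g \<omega>)"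
proof (rule strong_random_element_combine[OF assms(1,2)])
  show "(1 - t) *\<^sub>R x + t *\<^sub>R y \<in> V" if "x \<in> V" "y \<in> V" for x y
    using convexD[OF convex_V that, of "1 - t" t] assms by simp
qed (auto simp: case_prod_unfold intro!: continuous_intros)

text \<open>
  A countable gluing is the pointwise limit of finite ones.
\<close>

lemma E_first_hit:
  assumes h: "\<And>j. E (h j)" and Q: "\<And>j. Q j \<in> sets P" and ex: "\<And>\<omega>. \<omega> \<in> space P \<Longrightarrow> \<exists>j::nat. \<omega> \<in> Q j"
  shows "E (\<lambda>\<omega>. h (LEAST j. \<omega> \<in> Q j) \<omega>)"
proof -
  define G where "G n = (\<lambda>\<omega>. if \<exists>j<n. \<omega> \<in> Q j then h (LEAST j. \<omega> \<in> Q j) \<omega> else h 0 \<omega>)" for n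
  have "E (G n)" for n
  proof (induction n)
    case 0
    then show ?case using h[of 0] by (simp add: G_def)
  next
    case (Suc n)
    have "G (Suc n) = (\<lambda>\<omega>. if \<omega> \<in> Q n - (\<Union>j<n. Q j) then h n \<omega> else G n \<omega>)"
    proof
      fix \<omega>
      show "G (Suc n) \<omega> = (if \<omega> \<in> Q n - (\<Union>j<n. Q j) then h n \<omega> else G n \<omega>)"
      proof (cases "\<omega> \<in> Q n - (\<Union>j<n. Q j)")
        case True
        then have "(LEAST j. \<omega> \<in> Q j) = n"
          by (intro Least_equality) (auto simp: not_less[symmetric])
        then show ?thesis using True by (auto simp: G_def)
      qed (auto simp: G_def less_Suc_eq)
    qed
    moreover have "Q n - (\<Union>j<n. Q j) \<in> sets P" using Q by auto
    ultimately show ?case using strong_random_element_glue[OF h[of n] Suc] by presburger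
  qed
  then show ?thesis
  proof (rule strong_random_element_limit[OF _ closed_V])
    fix \<omega> assume "\<omega> \<in> space P"
    then obtain j where j: "\<omega> \<in> Q j" using ex by blast
    have "eventually (\<lambda>n. G n \<omega> = h (LEAST j. \<omega> \<in> Q j) \<omega>) sequentially"
      using eventually_gt_at_top[of j] by eventually_elim (use j in \<open>auto simp: G_def\<close>)
    then show "(\<lambda>n. G n \<omega>) \<longlonglongrightarrow> h (LEAST j. \<omega> \<in> Q j) \<omega>" by (rule tendsto_eventually)
  qed
qed

lemma E_mixture: "(\<And>n. E (f n)) \<Longrightarrow> E (mix f t)"
proof (induction t)
  case (Mix q s t)
  then show ?case using E_mix[of "mix f s" "mix f t" "weight q"] by (simp add: weight_bounds)
qed simp

text \<open>
  The summand \<open>1\<close> makes the bound positive and strict.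
\<close>

definition diam_bound :: real where "diam_bound = diameter V + 1"

lemma diam_bound_pos: "diam_bound > 0"
  using diameter_ge_0[OF bounded_V] by (simp add: diam_bound_def)

lemma dist_less_diam_bound: "x \<in> V \<Longrightarrow> y \<in> V \<Longrightarrow> dist x y < diam_bound"
  using diameter_bounded_bound[OF bounded_V] by (force simp: diam_bound_def)

definition tail_hull :: "(nat \<Rightarrow> 'w \<Rightarrow> 'b) \<Rightarrow> nat \<Rightarrow> 'w \<Rightarrow> 'b set" where
  "tail_hull f n \<omega> = closure {mix f t \<omega> | t. leaves t \<subseteq> {n..}}"

lemma tail_hull_props:
  assumes f: "\<And>n. E (f n)" and \<omega>: "\<omega> \<in> space P"
  shows "closed (tail_hull f n \<omega>)" "convex (tail_hull f n \<omega>)" "tail_hull f n \<omega> \<subseteq> V"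
    and "decseq (\<lambda>n. tail_hull f n \<omega>)"
    and "leaves t \<subseteq> {n..} \<Longrightarrow> mix f t \<omega> \<in> tail_hull f n \<omega>"
proof -
  show "closed (tail_hull f n \<omega>)" by (simp add: tail_hull_def)
  show "convex (tail_hull f n \<omega>)" unfolding tail_hull_def
  proof (rule convex_closure_rational, clarify)
    fix q s t assume "leaves s \<subseteq> {n..}" "leaves t \<subseteq> {n..}"
    then show "\<exists>u. (1 - weight q) *\<^sub>R mix f s \<omega> + weight q *\<^sub>R mix f t \<omega> = mix f u \<omega> \<and> leaves u \<subseteq> {n..}"
      by (intro exI[of _ "Mix q s t"]) simp
  qed
  show "tail_hull f n \<omega> \<subseteq> V" unfolding tail_hull_def
    using strong_random_element_in[OF E_mixture[OF f] \<omega>] by (intro closure_minimal closed_V) auto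
  show "decseq (\<lambda>n. tail_hull f n \<omega>)" unfolding tail_hull_def decseq_def
    by (intro allI impI closure_mono) force
  show "leaves t \<subseteq> {n..} \<Longrightarrow> mix f t \<omega> \<in> tail_hull f n \<omega>" unfolding tail_hull_def
    by (intro subsetD[OF closure_subset]) blast
qed

text \<open>
  In terms of the intersection \<open>W\<close> of the tail hulls at \<open>\<omega>\<close>: the distance from \<open>x\<close> to \<open>W\<close> is below
  \<open>q\<close>, up to replacing the strict inequality by a weak one.
\<close>

definition near_tails :: "(nat \<Rightarrow> 'w \<Rightarrow> 'b) \<Rightarrow> 'b \<Rightarrow> 'w \<Rightarrow> real \<Rightarrow> bool" where
  "near_tails f x \<omega> q \<longleftrightarrow> (\<forall>n. \<exists>t. leaves t \<subseteq> {n..} \<and> dist x (mix f t \<omega>) < q)"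

lemma near_tails_measurable:
  assumes f: "\<And>n. E (f n)" and g: "E g"
  shows "{\<omega>\<in>space P. near_tails f (g \<omega>) \<omega> q} \<in> sets P"
proof -
  have "{\<omega>\<in>space P. dist (g \<omega>) (mix f t \<omega>) < q} \<in> sets P" for t
    using strong_random_element_dist_measurable[OF g E_mixture[OF f]]
    by (rule borel_measurable_less) simp
  then have "{\<omega>\<in>space P. \<forall>n. \<exists>t. leaves t \<subseteq> {n..} \<and> dist (g \<omega>) (mix f t \<omega>) < q} \<in> sets P"
    by (intro sets.sets_Collect_countable_All sets.sets_Collect_countable_Ex sets.sets_Collect_conj sets.sets_Collect_const)
  then show ?thesis by (simp add: near_tails_def)
qed

text \<open>
  Weak compactness turns approximate distances to every tail hull into a true distance to their
  intersection. This makes nearness to the intersection expressible by countably many measurable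
  conditions.
\<close>

lemma near_tails_point:
  assumes f: "\<And>n. E (f n)" and \<omega>: "\<omega> \<in> space P" and near: "near_tails f x \<omega> q"
  shows "\<exists>w. (\<forall>n. w \<in> tail_hull f n \<omega>) \<and> dist x w \<le> q"
proof -
  have "(\<Inter>n. tail_hull f n \<omega> \<inter> cball x q) \<noteq> {}"
  proof (rule decseq_Inter)
    fix n
    obtain t where "leaves t \<subseteq> {n..}" "dist x (mix f t \<omega>) < q" using near by (auto simp: near_tails_def)
    then show "tail_hull f n \<omega> \<inter> cball x q \<noteq> {}" using tail_hull_props(5)[where f = f and t = t and n = n, OF f \<omega>] by fastforce
    show "closed (tail_hull f n \<omega> \<inter> cball x q)" "convex (tail_hull f n \<omega> \<inter> cball x q)"
      "tail_hull f n \<omega> \<inter> cball x q \<subseteq> V"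
      using tail_hull_props(1-3)[where f = f and n = n, OF f \<omega>] by (auto intro: convex_Int)
  next
    show "decseq (\<lambda>n. tail_hull f n \<omega> \<inter> cball x q)"
      using tail_hull_props(4)[OF f \<omega>] by (force simp: decseq_def)
  qed
  then obtain w where "\<And>n. w \<in> tail_hull f n \<omega> \<inter> cball x q" by blast
  then show ?thesis by (intro exI[of _ w]) auto
qed

text \<open>
  One step of a Kuratowski-Ryll-Nardzewski selection: take the first rational mixture that is close
  both to the previous approximation and to the intersection of the tail hulls.
\<close>

lemma near_tails_refine:
  assumes f: "\<And>n. E (f n)" and g: "E g" and q: "q > 0"
    and near: "\<And>\<omega>. \<omega> \<in> space P \<Longrightarrow> near_tails f (g \<omega>) \<omega> q"
  shows "\<exists>g'. E g' \<and> (\<forall>\<omega>\<in>space P. near_tails f (g' \<omega>) \<omega> (q/2) \<and> dist (g \<omega>) (g' \<omega>) < 2 * q)"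
proof -
  define h where "h j = mix f (from_nat j)" for j
  define Q where "Q j = {\<omega>\<in>space P. near_tails f (h j \<omega>) \<omega> (q/2)} \<inter> {\<omega>\<in>space P. dist (g \<omega>) (h j \<omega>) < 2 * q}" for j
  have Eh: "E (h j)" for j unfolding h_def by (rule E_mixture[OF f])
  have "{\<omega>\<in>space P. dist (g \<omega>) (h j \<omega>) < 2 * q} \<in> sets P" for j
    using strong_random_element_dist_measurable[OF g Eh] by (rule borel_measurable_less) simp
  then have Q: "Q j \<in> sets P" for j
    unfolding Q_def by (intro sets.Int near_tails_measurable f Eh)
  have ex: "\<exists>j. \<omega> \<in> Q j" if \<omega>: "\<omega> \<in> space P" for \<omega>
  proof -
    obtain w where w: "\<And>n. w \<in> tail_hull f n \<omega>" "dist (g \<omega>) w \<le> q"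
      using near_tails_point[OF f \<omega> near[OF \<omega>]] by blast
    obtain t where t: "dist (mix f t \<omega>) w < q/2"
      using w(1)[of 0, unfolded tail_hull_def closure_approachable, rule_format, of "q/2"] q by auto
    have "near_tails f (mix f t \<omega>) \<omega> (q/2)" unfolding near_tails_def
    proof
      fix n
      have "q/2 - dist (mix f t \<omega>) w > 0" using t by simp
      then obtain s where "leaves s \<subseteq> {n..}" "dist (mix f s \<omega>) w < q/2 - dist (mix f t \<omega>) w"
        using w(1)[of n] unfolding tail_hull_def closure_approachable by blast
      then show "\<exists>s. leaves s \<subseteq> {n..} \<and> dist (mix f t \<omega>) (mix f s \<omega>) < q/2"
        using dist_triangle2[of "mix f t \<omega>" "mix f s \<omega>" w] by (intro exI[of _ s]) simp
    qed
    moreover have "dist (g \<omega>) (mix f t \<omega>) < 2 * q"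
      using dist_triangle2[of "g \<omega>" "mix f t \<omega>" w] w t q by simp
    ultimately have "\<omega> \<in> Q (to_nat t)" using \<omega> by (simp add: Q_def h_def)
    then show ?thesis by blast
  qed
  define g' where "g' = (\<lambda>\<omega>. h (LEAST j. \<omega> \<in> Q j) \<omega>)"
  have "E g'" unfolding g'_def by (rule E_first_hit[OF Eh Q ex])
  moreover have "near_tails f (g' \<omega>) \<omega> (q/2) \<and> dist (g \<omega>) (g' \<omega>) < 2 * q" if "\<omega> \<in> space P" for \<omega>
  proof -
    define j where "j = (LEAST j. \<omega> \<in> Q j)"
    have "\<omega> \<in> Q j" unfolding j_def by (rule LeastI_ex[OF ex[OF that]])
    moreover have "g' \<omega> = h j \<omega>" by (simp add: g'_def j_def)
    ultimately show ?thesis by (simp add: Q_def)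
  qed
  ultimately show ?thesis by blast
qed

lemma measurable_selection:
  assumes f: "\<And>n. E (f n)"
  shows "\<exists>g. E g \<and> (\<forall>\<omega>\<in>space P. \<forall>n. g \<omega> \<in> tail_hull f n \<omega>)"
proof -
  have "\<exists>G. \<forall>k. (E (G k) \<and> (\<forall>\<omega>\<in>space P. near_tails f (G k \<omega>) \<omega> (diam_bound / 2^k))) \<and>
     (\<forall>\<omega>\<in>space P. dist (G k \<omega>) (G (Suc k) \<omega>) < 2 * (diam_bound / 2^k))"
  proof (rule dependent_nat_choice)
    have "near_tails f (f 0 \<omega>) \<omega> (diam_bound / 2^0)" if \<omega>: "\<omega> \<in> space P" for \<omega>
      unfolding near_tails_def
    proof
      fix n
      show "\<exists>t. leaves t \<subseteq> {n..} \<and> dist (f 0 \<omega>) (mix f t \<omega>) < diam_bound / 2^0"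
        using dist_less_diam_bound[OF strong_random_element_in[OF f \<omega>] strong_random_element_in[OF f \<omega>], of 0 n]
        by (intro exI[of _ "Leaf n"]) simp
    qed
    then show "\<exists>g. E g \<and> (\<forall>\<omega>\<in>space P. near_tails f (g \<omega>) \<omega> (diam_bound / 2^0))" using f by blast
  next
    fix g k assume "E g \<and> (\<forall>\<omega>\<in>space P. near_tails f (g \<omega>) \<omega> (diam_bound / 2^k))"
    then show "\<exists>g'. (E g' \<and> (\<forall>\<omega>\<in>space P. near_tails f (g' \<omega>) \<omega> (diam_bound / 2^Suc k))) \<and>
       (\<forall>\<omega>\<in>space P. dist (g \<omega>) (g' \<omega>) < 2 * (diam_bound / 2^k))"
      using near_tails_refine[OF f, of g "diam_bound / 2^k"] diam_bound_pos by (force simp: mult.commute)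
  qed
  then obtain G where G: "\<And>k. E (G k)" "\<And>k \<omega>. \<omega> \<in> space P \<Longrightarrow> near_tails f (G k \<omega>) \<omega> (diam_bound / 2^k)"
     "\<And>k \<omega>. \<omega> \<in> space P \<Longrightarrow> dist (G k \<omega>) (G (Suc k) \<omega>) < 2 * (diam_bound / 2^k)" by blast
  define g where "g \<omega> = lim (\<lambda>k. G k \<omega>)" for \<omega>
  have lim: "(\<lambda>k. G k \<omega>) \<longlonglongrightarrow> g \<omega>" if \<omega>: "\<omega> \<in> space P" for \<omega>
  proof -
    have "summable (\<lambda>k. G (Suc k) \<omega> - G k \<omega>)"
    proof (rule summable_comparison_test)
      show "\<exists>N. \<forall>k\<ge>N. norm (G (Suc k) \<omega> - G k \<omega>) \<le> 2 * diam_bound * (1/2)^k"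
        using G(3)[OF \<omega>] by (auto simp: dist_norm norm_minus_commute power_divide less_imp_le)
      show "summable (\<lambda>k. 2 * diam_bound * (1/2)^k)" by (intro summable_mult summable_geometric) simp
    qed
    then have "(\<lambda>n. \<Sum>k<n. G (Suc k) \<omega> - G k \<omega>) \<longlonglongrightarrow> (\<Sum>k. G (Suc k) \<omega> - G k \<omega>)"
      by (rule summable_LIMSEQ)
    then have "(\<lambda>n. G 0 \<omega> + (G n \<omega> - G 0 \<omega>)) \<longlonglongrightarrow> G 0 \<omega> + (\<Sum>k. G (Suc k) \<omega> - G k \<omega>)"
      by (intro tendsto_add tendsto_const) (simp add: sum_lessThan_telescope[of "\<lambda>k. G k \<omega>"])
    then show ?thesis unfolding g_def by (simp add: convergent_LIMSEQ_iff[symmetric] convergentI)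
  qed
  have "g \<omega> \<in> tail_hull f n \<omega>" if \<omega>: "\<omega> \<in> space P" for \<omega> n
    unfolding tail_hull_def closure_approachable
  proof (intro allI impI)
    fix \<epsilon> :: real assume \<epsilon>: "\<epsilon> > 0"
    have "(\<lambda>k. diam_bound * (1/2)^k) \<longlonglongrightarrow> 0"
      by (rule tendsto_mult_right_zero[OF LIMSEQ_power_zero]) simp
    then have "eventually (\<lambda>k. diam_bound * (1/2)^k < \<epsilon>/2) sequentially" using \<epsilon> by (intro order_tendstoD(2)) auto
    moreover have "eventually (\<lambda>k. dist (G k \<omega>) (g \<omega>) < \<epsilon>/2) sequentially"
      using lim[OF \<omega>] \<epsilon> by (intro tendstoD) auto
    ultimately have "eventually (\<lambda>k. diam_bound * (1/2)^k < \<epsilon>/2 \<and> dist (G k \<omega>) (g \<omega>) < \<epsilon>/2) sequentially"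
      by (rule eventually_conj)
    then obtain k where k: "diam_bound * (1/2)^k < \<epsilon>/2" "dist (G k \<omega>) (g \<omega>) < \<epsilon>/2"
      by (auto simp: eventually_sequentially)
    obtain t where "leaves t \<subseteq> {n..}" "dist (G k \<omega>) (mix f t \<omega>) < diam_bound / 2^k"
      using G(2)[OF \<omega>, of k] by (auto simp: near_tails_def)
    moreover have "diam_bound / 2^k = diam_bound * (1/2)^k" by (simp add: power_divide)
    ultimately have "dist (mix f t \<omega>) (g \<omega>) < \<epsilon>" "leaves t \<subseteq> {n..}"
      using k dist_triangle3[of "mix f t \<omega>" "g \<omega>" "G k \<omega>"] by linarith+
    then show "\<exists>y\<in>{mix f t \<omega> | t. leaves t \<subseteq> {n..}}. dist y (g \<omega>) < \<epsilon>" by blast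
  qed
  moreover have "E g" by (rule strong_random_element_limit[OF G(1) closed_V lim])
  ultimately show ?thesis by blast
qed

end

section \<open>Integrated distances and admissible sets\<close>

context random_convex_set
begin

text \<open>
  The range of \<open>A\<close> over all events stands in for pointwise distances.
\<close>

definition L1 :: "'w set \<Rightarrow> ('w \<Rightarrow> 'b) \<Rightarrow> ('w \<Rightarrow> 'b) \<Rightarrow> real" where
  "L1 A f g = (\<integral>\<omega>. indicator A \<omega> * dist (f \<omega>) (g \<omega>) \<partial>P)"

lemma dist_integrable:
  assumes "E f" "E g"
  shows "integrable P (\<lambda>\<omega>. dist (f \<omega>) (g \<omega>))"
proof (rule integrable_const_bound[where B = diam_bound])
  show "AE \<omega> in P. norm (dist (f \<omega>) (g \<omega>)) \<le> diam_bound"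
    using dist_less_diam_bound strong_random_element_in[OF assms(1)] strong_random_element_in[OF assms(2)]
    by (auto simp: less_imp_le)
qed (rule strong_random_element_dist_measurable[OF assms])

lemma L1_integrable:
  assumes "E f" "E g" "A \<in> sets P"
  shows "integrable P (\<lambda>\<omega>. indicator A \<omega> * dist (f \<omega>) (g \<omega>))"
  using integrable_real_mult_indicator[OF assms(3) dist_integrable[OF assms(1,2)]] by (simp add: mult.commute)

lemma L1_nonneg: "0 \<le> L1 A f g"
  unfolding L1_def by (rule Bochner_Integration.integral_nonneg) simp

lemma L1_commute: "L1 A f g = L1 A g f"
  by (simp add: L1_def dist_commute)

lemma L1_cong:
  assumes "\<And>\<omega>. \<omega> \<in> space P \<Longrightarrow> f \<omega> = f' \<omega>" "\<And>\<omega>. \<omega> \<in> space P \<Longrightarrow> g \<omega> = g' \<omega>"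
  shows "L1 A f g = L1 A f' g'"
  unfolding L1_def by (rule Bochner_Integration.integral_cong) (use assms in auto)

lemma L1_mono_dist:
  assumes "E f" "E g" "E f'" "E g'" "A \<in> sets P"
    and "\<And>\<omega>. \<omega> \<in> space P \<Longrightarrow> dist (f \<omega>) (g \<omega>) \<le> dist (f' \<omega>) (g' \<omega>)"
  shows "L1 A f g \<le> L1 A f' g'"
  unfolding L1_def by (rule integral_mono) (use assms in \<open>auto intro!: L1_integrable mult_left_mono\<close>)

lemma L1_mono:
  assumes "E f" "E g" "A \<in> sets P" "A' \<in> sets P" "A \<subseteq> A'"
  shows "L1 A f g \<le> L1 A' f g"
  unfolding L1_def
  using assms(5) by (intro integral_mono L1_integrable assms(1-4) mult_right_mono) (auto simp: indicator_def)

lemma L1_le_diam_bound: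
  assumes "E f" "E g" "A \<in> sets P"
  shows "L1 A f g \<le> diam_bound"
proof -
  have "L1 A f g \<le> (\<integral>\<omega>. diam_bound \<partial>P)" unfolding L1_def
  proof (rule integral_mono[OF L1_integrable[OF assms]])
    fix \<omega> assume "\<omega> \<in> space P"
    then show "indicator A \<omega> * dist (f \<omega>) (g \<omega>) \<le> diam_bound"
      using dist_less_diam_bound[of "f \<omega>" "g \<omega>"] assms(1,2)[THEN strong_random_element_in] diam_bound_pos
      by (auto simp: indicator_def less_imp_le)
  qed simp
  then show ?thesis by (simp add: prob_space)
qed

lemma L1_triangle:
  assumes "E f" "E g" "E h" "A \<in> sets P"
  shows "L1 A f h \<le> L1 A f g + L1 A g h"
proof -
  have "L1 A f h \<le> (\<integral>\<omega>. indicator A \<omega> * dist (f \<omega>) (g \<omega>) + indicator A \<omega> * dist (g \<omega>) (h \<omega>) \<partial>P)"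
    unfolding L1_def
  proof (rule integral_mono)
    fix \<omega>
    show "indicator A \<omega> * dist (f \<omega>) (h \<omega>) \<le> indicator A \<omega> * dist (f \<omega>) (g \<omega>) + indicator A \<omega> * dist (g \<omega>) (h \<omega>)"
      by (auto simp: indicator_def dist_triangle)
  qed (use assms in \<open>auto intro!: L1_integrable Bochner_Integration.integrable_add\<close>)
  also have "\<dots> = L1 A f g + L1 A g h"
    unfolding L1_def by (rule Bochner_Integration.integral_add) (use assms in \<open>auto intro!: L1_integrable\<close>)
  finally show ?thesis .
qed

definition glue :: "'w set \<Rightarrow> ('w \<Rightarrow> 'b) \<Rightarrow> ('w \<Rightarrow> 'b) \<Rightarrow> 'w \<Rightarrow> 'b" where
  "glue A f g = (\<lambda>\<omega>. if \<omega> \<in> A then f \<omega> else g \<omega>)"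

lemma glue_same [simp]: "glue A f f = f"
  by (simp add: glue_def)

lemma E_glue: "E f \<Longrightarrow> E g \<Longrightarrow> A \<in> sets P \<Longrightarrow> E (glue A f g)"
  unfolding glue_def by (rule strong_random_element_glue)

text \<open>
  Distances integrated over an event split along any gluing set, so an additive quantity can be
  optimised on complementary events independently.
\<close>

lemma L1_glue:
  assumes "E f" "E f'" "E g" "E g'" "A \<in> sets P" "C \<in> sets P"
  shows "L1 A (glue C f f') (glue C g g') = L1 (A \<inter> C) f g + L1 (A - C) f' g'"
proof -
  have "L1 A (glue C f f') (glue C g g') =
     (\<integral>\<omega>. indicator (A \<inter> C) \<omega> * dist (f \<omega>) (g \<omega>) + indicator (A - C) \<omega> * dist (f' \<omega>) (g' \<omega>) \<partial>P)"
    unfolding L1_def by (rule Bochner_Integration.integral_cong) (auto simp: glue_def indicator_def)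
  also have "\<dots> = L1 (A \<inter> C) f g + L1 (A - C) f' g'"
    unfolding L1_def by (rule Bochner_Integration.integral_add) (use assms in \<open>auto intro!: L1_integrable\<close>)
  finally show ?thesis .
qed

lemma L1_convex:
  assumes "E f" "E f'" "E g" "A \<in> sets P" "0 \<le> t" "t \<le> 1"
  shows "L1 A (\<lambda>\<omega>. (1 - t) *\<^sub>R f \<omega> + t *\<^sub>R f' \<omega>) g \<le> (1 - t) * L1 A f g + t * L1 A f' g"
proof -
  have "L1 A (\<lambda>\<omega>. (1 - t) *\<^sub>R f \<omega> + t *\<^sub>R f' \<omega>) g \<le>
     (\<integral>\<omega>. (1 - t) * (indicator A \<omega> * dist (f \<omega>) (g \<omega>)) + t * (indicator A \<omega> * dist (f' \<omega>) (g \<omega>)) \<partial>P)"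
    unfolding L1_def
  proof (rule integral_mono)
    fix \<omega>
    have "((1 - t) *\<^sub>R f \<omega> + t *\<^sub>R f' \<omega>) - g \<omega> = (1 - t) *\<^sub>R (f \<omega> - g \<omega>) + t *\<^sub>R (f' \<omega> - g \<omega>)"
      by (simp add: algebra_simps)
    then have "dist ((1 - t) *\<^sub>R f \<omega> + t *\<^sub>R f' \<omega>) (g \<omega>) \<le> (1 - t) * dist (f \<omega>) (g \<omega>) + t * dist (f' \<omega>) (g \<omega>)"
      using assms(5,6) norm_triangle_ineq[of "(1 - t) *\<^sub>R (f \<omega> - g \<omega>)" "t *\<^sub>R (f' \<omega> - g \<omega>)"]
      by (simp add: dist_norm)
    then show "indicator A \<omega> * dist ((1 - t) *\<^sub>R f \<omega> + t *\<^sub>R f' \<omega>) (g \<omega>) \<le>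
       (1 - t) * (indicator A \<omega> * dist (f \<omega>) (g \<omega>)) + t * (indicator A \<omega> * dist (f' \<omega>) (g \<omega>))"
      by (simp add: indicator_def)
  qed (use assms in \<open>auto intro!: L1_integrable E_mix\<close>)
  also have "\<dots> = (1 - t) * L1 A f g + t * L1 A f' g"
    unfolding L1_def using assms by (subst Bochner_Integration.integral_add) (auto intro!: L1_integrable)
  finally show ?thesis .
qed

lemma L1_tendsto_zero:
  assumes h: "\<And>n. E (h n)" and f: "\<And>n. E (f n)" and lim: "AE \<omega> in P. (\<lambda>n. dist (f n \<omega>) (h n \<omega>)) \<longlonglongrightarrow> 0"
  shows "(\<lambda>n. L1 (space P) (f n) (h n)) \<longlonglongrightarrow> 0"
proof -
  have "(\<lambda>n. L1 (space P) (f n) (h n)) \<longlonglongrightarrow> (\<integral>\<omega>. 0 \<partial>P)"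
    unfolding L1_def
  proof (rule integral_dominated_convergence[where w = "\<lambda>_. diam_bound"])
    show "AE \<omega> in P. (\<lambda>n. indicator (space P) \<omega> * dist (f n \<omega>) (h n \<omega>)) \<longlonglongrightarrow> 0"
      using lim AE_space by eventually_elim simp
    show "AE \<omega> in P. norm (indicator (space P) \<omega> * dist (f n \<omega>) (h n \<omega>)) \<le> diam_bound" for n
      using AE_space
    proof eventually_elim
      case (elim \<omega>)
      then show ?case
        using dist_less_diam_bound[OF strong_random_element_in[OF f[of n] elim] strong_random_element_in[OF h[of n] elim]]
        by simp
    qed
    show "(\<lambda>\<omega>. indicator (space P) \<omega> * dist (f n \<omega>) (h n \<omega>)) \<in> borel_measurable P" for n
      by (rule borel_measurable_integrable[OF L1_integrable[OF f h sets.top]])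
  qed simp_all
  then show ?thesis by simp
qed

lemma L1_zero_AE:
  assumes "E f" "E g" "L1 (space P) f g = 0"
  shows "AE \<omega> in P. f \<omega> = g \<omega>"
proof -
  have "L1 (space P) f g = (\<integral>\<omega>. dist (f \<omega>) (g \<omega>) \<partial>P)"
    unfolding L1_def by (rule Bochner_Integration.integral_cong) auto
  then have "AE \<omega> in P. dist (f \<omega>) (g \<omega>) = 0"
    using integral_nonneg_eq_0_iff_AE[OF dist_integrable[OF assms(1,2)]] assms(3) by simp
  then show ?thesis by eventually_elim simp
qed

end

locale commuting_operators = random_convex_set P V for P :: "'w measure" and V :: "'b::banach set" +
  fixes S :: "('w \<Rightarrow> 'b \<Rightarrow> 'b) set"
  assumes nonexpansive_op: "\<And>\<sigma>. \<sigma> \<in> S \<Longrightarrow> strong_random_nonexpansive_operator P V V \<sigma>"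
    and commute_op: "\<And>\<sigma> \<tau> \<omega> x. \<sigma> \<in> S \<Longrightarrow> \<tau> \<in> S \<Longrightarrow> \<omega> \<in> space P \<Longrightarrow> x \<in> V \<Longrightarrow> \<sigma> \<omega> (\<tau> \<omega> x) = \<tau> \<omega> (\<sigma> \<omega> x)"
    and id_op: "(\<lambda>\<omega> x. x) \<in> S"
    and comp_op: "\<And>\<sigma> \<tau>. \<sigma> \<in> S \<Longrightarrow> \<tau> \<in> S \<Longrightarrow> (\<lambda>\<omega> x. \<sigma> \<omega> (\<tau> \<omega> x)) \<in> S"
begin

definition act :: "('w \<Rightarrow> 'b \<Rightarrow> 'b) \<Rightarrow> ('w \<Rightarrow> 'b) \<Rightarrow> 'w \<Rightarrow> 'b" where
  "act \<sigma> f = (\<lambda>\<omega>. \<sigma> \<omega> (f \<omega>))"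

lemma E_act: "\<sigma> \<in> S \<Longrightarrow> E f \<Longrightarrow> E (act \<sigma> f)"
  unfolding act_def by (rule strong_random_operator_apply[OF nonexpansive_op closed_V])

lemma act_dist_le:
  assumes "\<sigma> \<in> S" "E f" "E g" "\<omega> \<in> space P"
  shows "dist (act \<sigma> f \<omega>) (act \<sigma> g \<omega>) \<le> dist (f \<omega>) (g \<omega>)"
  using nonexpansive_op[OF assms(1)] strong_random_element_in[OF assms(2,4)] strong_random_element_in[OF assms(3,4)] assms(4)
  by (simp add: act_def strong_random_nonexpansive_operator_def random_nonexpansive_def)

lemma L1_act_le:
  assumes "\<sigma> \<in> S" "E f" "E g" "A \<in> sets P"
  shows "L1 A (act \<sigma> f) (act \<sigma> g) \<le> L1 A f g"
  by (rule L1_mono_dist) (use assms in \<open>auto intro: E_act act_dist_le\<close>)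

lemma act_glue: "act \<sigma> (glue A f g) = glue A (act \<sigma> f) (act \<sigma> g)"
  by (auto simp: act_def glue_def)

definition admissible :: "('w \<Rightarrow> 'b) set \<Rightarrow> bool" where
  "admissible D \<longleftrightarrow> D \<noteq> {} \<and> (\<forall>f\<in>D. E f) \<and>
     (\<forall>f\<in>D. \<forall>g\<in>D. \<forall>A\<in>sets P. glue A f g \<in> D) \<and>
     (\<forall>f\<in>D. \<forall>g\<in>D. \<forall>t\<in>{0..1}. (\<lambda>\<omega>. (1 - t) *\<^sub>R f \<omega> + t *\<^sub>R g \<omega>) \<in> D) \<and>
     (\<forall>f. E f \<longrightarrow> (\<forall>\<epsilon>>0. \<exists>h\<in>D. L1 (space P) f h < \<epsilon>) \<longrightarrow> f \<in> D) \<and>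
     (\<forall>\<sigma>\<in>S. \<forall>f\<in>D. act \<sigma> f \<in> D)"

lemma admissibleD:
  assumes "admissible D"
  shows "D \<noteq> {}" "f \<in> D \<Longrightarrow> E f" "f \<in> D \<Longrightarrow> g \<in> D \<Longrightarrow> A \<in> sets P \<Longrightarrow> glue A f g \<in> D"
    "f \<in> D \<Longrightarrow> g \<in> D \<Longrightarrow> 0 \<le> t \<Longrightarrow> t \<le> 1 \<Longrightarrow> (\<lambda>\<omega>. (1 - t) *\<^sub>R f \<omega> + t *\<^sub>R g \<omega>) \<in> D"
    "E f \<Longrightarrow> (\<And>\<epsilon>. \<epsilon> > 0 \<Longrightarrow> \<exists>h\<in>D. L1 (space P) f h < \<epsilon>) \<Longrightarrow> f \<in> D"
    "\<sigma> \<in> S \<Longrightarrow> f \<in> D \<Longrightarrow> act \<sigma> f \<in> D"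
  using assms unfolding admissible_def by auto

lemma admissible_all: "admissible {f. E f}"
proof -
  obtain v where "v \<in> V" using V_nonempty by auto
  then have "E (\<lambda>\<omega>. v)" by (rule strong_random_element_const)
  then show ?thesis by (auto simp: admissible_def intro: E_glue E_mix E_act)
qed

lemma admissible_limit:
  assumes D: "admissible D" and h: "\<And>n. h n \<in> D" and f: "E f"
    and lim: "\<And>\<omega>. \<omega> \<in> space P \<Longrightarrow> (\<lambda>n. h n \<omega>) \<longlonglongrightarrow> f \<omega>"
  shows "f \<in> D"
proof (rule admissibleD(5)[OF D f])
  fix \<epsilon> :: real assume "\<epsilon> > 0"
  have "(\<lambda>n. dist (f \<omega>) (h n \<omega>)) \<longlonglongrightarrow> 0" if "\<omega> \<in> space P" for \<omega>
    using tendsto_dist[OF tendsto_const[of "f \<omega>"] lim[OF that]] by simp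
  then have "(\<lambda>n. L1 (space P) f (h n)) \<longlonglongrightarrow> 0"
    by (intro L1_tendsto_zero[where f = "\<lambda>_. f"] admissibleD(2)[OF D h] f AE_I2)
  then have "eventually (\<lambda>n. L1 (space P) f (h n) < \<epsilon>) sequentially"
    using \<open>\<epsilon> > 0\<close> by (rule order_tendstoD)
  then show "\<exists>h\<in>D. L1 (space P) f h < \<epsilon>" using h by (auto simp: eventually_sequentially)
qed

lemma mix_in_admissible:
  assumes "admissible D" "\<And>k. k \<in> leaves t \<Longrightarrow> f k \<in> D"
  shows "mix f t \<in> D"
  using assms(2)
  by (induction t) (auto intro!: admissibleD(4)[OF assms(1)] simp: weight_bounds)

text \<open>
  The mixtures of \<open>f n, f (n+1), \<dots>\<close> lie in \<open>D\<close>, and the best approximants of \<open>g\<close> among them are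
  finite gluings of such mixtures that converge to \<open>g\<close>.
\<close>

lemma selection_in_admissible:
  assumes D: "admissible D" and f: "\<And>k. k \<ge> n \<Longrightarrow> f k \<in> D" and Ef: "\<And>k. E (f k)"
    and g: "E g" "\<And>\<omega>. \<omega> \<in> space P \<Longrightarrow> g \<omega> \<in> tail_hull f n \<omega>"
  shows "g \<in> D"
proof -
  \<comment> \<open>Codes of mixtures that use an index below \<open>n\<close> are replaced by \<open>f n\<close>.\<close>
  define v where "v j = (if leaves (from_nat j) \<subseteq> {n..} then mix f (from_nat j) else f n)" for j
  have v: "v j \<in> D" for j
    unfolding v_def using f by (auto intro!: mix_in_admissible[OF D])
  have sub: "{mix f t \<omega> | t. leaves t \<subseteq> {n..}} \<subseteq> range (\<lambda>j. v j \<omega>)" for \<omega>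
  proof clarify
    fix t assume "leaves t \<subseteq> {n..}"
    then have "mix f t \<omega> = v (to_nat t) \<omega>" by (simp add: v_def)
    then show "mix f t \<omega> \<in> range (\<lambda>j. v j \<omega>)" by blast
  qed
  show ?thesis
  proof (rule admissible_limit[OF D _ g(1)])
    show "best_approximant (space P) g v k \<in> D" for k
    proof (rule best_approximant_in[OF v])
      show "(\<lambda>\<omega>. if \<omega> \<in> A then h \<omega> else h' \<omega>) \<in> D" if "A \<in> sets P" "h \<in> D" "h' \<in> D" for A h h'
        using admissibleD(3)[OF D that(2,3,1)] by (simp add: glue_def)
      show "(\<lambda>\<omega>. dist (g \<omega>) (h \<omega>)) \<in> borel_measurable P" if "h \<in> D" for h
        by (rule strong_random_element_dist_measurable[OF g(1) admissibleD(2)[OF D that]])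
    qed
    show "(\<lambda>k. best_approximant (space P) g v k \<omega>) \<longlonglongrightarrow> g \<omega>" if "\<omega> \<in> space P" for \<omega>
    proof (rule best_approximant_tendsto[OF that])
      show "g \<omega> \<in> closure (range (\<lambda>n. v n \<omega>))"
        using g(2)[OF that] closure_mono[OF sub] unfolding tail_hull_def by blast
    qed
  qed
qed

text \<open>
  The countable compactness of the family of admissible sets. Sequences suffice for the whole
  argument, so that a measurable selection is always available.
\<close>

lemma admissible_Inter:
  assumes D: "\<And>n. admissible (D n)" and dec: "decseq D"
  shows "admissible (\<Inter>n. D n)"
proof -
  have "\<forall>n. \<exists>f. f \<in> D n" using admissibleD(1)[OF D] by blast
  then obtain f where f: "\<And>n. f n \<in> D n" by metis
  have Ef: "E (f n)" for n by (rule admissibleD(2)[OF D f])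
  obtain g where g: "E g" "\<And>\<omega> n. \<omega> \<in> space P \<Longrightarrow> g \<omega> \<in> tail_hull f n \<omega>"
    using measurable_selection[where f = f, OF Ef] by blast
  have "g \<in> D n" for n
  proof (rule selection_in_admissible[OF D _ Ef g])
    fix k assume "n \<le> k"
    then show "f k \<in> D n" using f[of k] dec by (auto simp: decseq_def)
  qed
  then have ne: "(\<Inter>n. D n) \<noteq> {}" by blast
  show ?thesis unfolding admissible_def
  proof (intro conjI ballI allI impI)
    fix f assume "E f" "\<forall>\<epsilon>>0. \<exists>h\<in>\<Inter>n. D n. L1 (space P) f h < \<epsilon>"
    then have "f \<in> D n" for n by (intro admissibleD(5)[OF D]) auto
    then show "f \<in> (\<Inter>n. D n)" by blast
  qed (use ne admissibleD(2-4,6)[OF D] in auto)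
qed

end

section \<open>Asymptotic radii\<close>

context commuting_operators
begin

definition reach :: "('w \<Rightarrow> 'b) set \<Rightarrow> 'w set \<Rightarrow> ('w \<Rightarrow> 'b) \<Rightarrow> ('w \<Rightarrow> 'b \<Rightarrow> 'b) \<Rightarrow> real" where
  "reach D A z \<sigma> = (SUP x\<in>D. L1 A z (act \<sigma> x))"

text \<open>
  The asymptotic radius about \<open>z\<close> of the net of sets \<open>\<sigma> D\<close>, which shrink as operators are composed.
\<close>

definition radius :: "('w \<Rightarrow> 'b) set \<Rightarrow> 'w set \<Rightarrow> ('w \<Rightarrow> 'b) \<Rightarrow> real" where
  "radius D A z = (INF \<sigma>\<in>S. reach D A z \<sigma>)"

definition sup_radius :: "('w \<Rightarrow> 'b) set \<Rightarrow> real" where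
  "sup_radius D = (SUP z\<in>D. radius D (space P) z)"

context
  fixes D assumes D: "admissible D"
begin

lemmas D_E = admissibleD(2)[OF D]

lemma reach_bdd:
  assumes "E z" "A \<in> sets P" "\<sigma> \<in> S"
  shows "bdd_above ((\<lambda>x. L1 A z (act \<sigma> x)) ` D)"
proof (rule bdd_aboveI2)
  fix x assume "x \<in> D"
  show "L1 A z (act \<sigma> x) \<le> diam_bound"
    by (rule L1_le_diam_bound[OF assms(1) E_act[OF assms(3) D_E[OF \<open>x \<in> D\<close>]] assms(2)])
qed

lemma L1_le_reach:
  assumes "E z" "A \<in> sets P" "\<sigma> \<in> S" "x \<in> D"
  shows "L1 A z (act \<sigma> x) \<le> reach D A z \<sigma>"
  unfolding reach_def by (rule cSUP_upper[OF assms(4) reach_bdd[OF assms(1-3)]])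

lemma reach_least: "(\<And>x. x \<in> D \<Longrightarrow> L1 A z (act \<sigma> x) \<le> c) \<Longrightarrow> reach D A z \<sigma> \<le> c"
  unfolding reach_def by (rule cSUP_least[OF admissibleD(1)[OF D]])

lemma reach_nonneg:
  assumes "E z" "A \<in> sets P" "\<sigma> \<in> S"
  shows "0 \<le> reach D A z \<sigma>"
proof -
  obtain x where "x \<in> D" using admissibleD(1)[OF D] by auto
  then show ?thesis using L1_le_reach[OF assms] L1_nonneg[of A z "act \<sigma> x"] by (meson order_trans)
qed

lemma reach_approx:
  assumes "\<epsilon> > 0"
  shows "\<exists>x\<in>D. L1 A z (act \<sigma> x) > reach D A z \<sigma> - \<epsilon>"
  using reach_least[of A z \<sigma> "reach D A z \<sigma> - \<epsilon>"] assms by force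

lemma radius_le_reach:
  assumes "E z" "A \<in> sets P" "\<sigma> \<in> S"
  shows "radius D A z \<le> reach D A z \<sigma>"
  unfolding radius_def
  by (rule cINF_lower[OF _ assms(3)]) (use reach_nonneg[OF assms(1,2)] in \<open>auto intro!: bdd_belowI2[of _ 0]\<close>)

lemma radius_greatest: "(\<And>\<sigma>. \<sigma> \<in> S \<Longrightarrow> c \<le> reach D A z \<sigma>) \<Longrightarrow> c \<le> radius D A z"
  unfolding radius_def by (rule cINF_greatest) (use id_op in auto)

lemma radius_nonneg: "E z \<Longrightarrow> A \<in> sets P \<Longrightarrow> 0 \<le> radius D A z"
  by (intro radius_greatest reach_nonneg)

text \<open>
  By commutativity composition is an upper bound in the direction of shrinking image sets.
\<close>

lemma reach_comp_le:
  assumes "E z" "A \<in> sets P" "\<sigma> \<in> S" "\<tau> \<in> S"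
  shows "reach D A z (\<lambda>\<omega> x. \<sigma> \<omega> (\<tau> \<omega> x)) \<le> reach D A z \<sigma>"
    and "reach D A z (\<lambda>\<omega> x. \<sigma> \<omega> (\<tau> \<omega> x)) \<le> reach D A z \<tau>"
proof -
  show "reach D A z (\<lambda>\<omega> x. \<sigma> \<omega> (\<tau> \<omega> x)) \<le> reach D A z \<sigma>"
  proof (rule reach_least)
    fix x assume "x \<in> D"
    then show "L1 A z (act (\<lambda>\<omega> x. \<sigma> \<omega> (\<tau> \<omega> x)) x) \<le> reach D A z \<sigma>"
      using L1_le_reach[OF assms(1-3), of "act \<tau> x"] admissibleD(6)[OF D assms(4)] by (simp add: act_def)
  qed
  show "reach D A z (\<lambda>\<omega> x. \<sigma> \<omega> (\<tau> \<omega> x)) \<le> reach D A z \<tau>"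
  proof (rule reach_least)
    fix x assume x: "x \<in> D"
    have "L1 A z (act (\<lambda>\<omega> x. \<sigma> \<omega> (\<tau> \<omega> x)) x) = L1 A z (act \<tau> (act \<sigma> x))"
      using commute_op[OF assms(3,4) _ strong_random_element_in[OF D_E[OF x]]]
      by (intro L1_cong) (auto simp: act_def)
    also have "\<dots> \<le> reach D A z \<tau>"
      by (rule L1_le_reach[OF assms(1,2,4) admissibleD(6)[OF D assms(3) x]])
    finally show "L1 A z (act (\<lambda>\<omega> x. \<sigma> \<omega> (\<tau> \<omega> x)) x) \<le> reach D A z \<tau>" .
  qed
qed

lemma radius_approx:
  assumes "\<epsilon> > 0"
  shows "\<exists>\<sigma>\<in>S. reach D A z \<sigma> < radius D A z + \<epsilon>"
  using radius_greatest[of "radius D A z + \<epsilon>" A z] assms by force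

lemma radius_approx_many:
  fixes m :: nat
  assumes z: "\<And>i. i < m \<Longrightarrow> E (z i)" "\<And>i. i < m \<Longrightarrow> A i \<in> sets P" and \<epsilon>: "\<epsilon> > 0"
  shows "\<exists>\<sigma>\<in>S. \<forall>i<m. reach D (A i) (z i) \<sigma> < radius D (A i) (z i) + \<epsilon>"
  using z
proof (induction m)
  case 0
  then show ?case using id_op by auto
next
  case (Suc m)
  obtain \<sigma> where \<sigma>: "\<sigma> \<in> S" "\<And>i. i < m \<Longrightarrow> reach D (A i) (z i) \<sigma> < radius D (A i) (z i) + \<epsilon>"
    using Suc.IH Suc.prems by (metis less_SucI)
  obtain \<tau> where \<tau>: "\<tau> \<in> S" "reach D (A m) (z m) \<tau> < radius D (A m) (z m) + \<epsilon>"
    using radius_approx[OF \<epsilon>] by blast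
  have "reach D (A i) (z i) (\<lambda>\<omega> x. \<sigma> \<omega> (\<tau> \<omega> x)) < radius D (A i) (z i) + \<epsilon>" if i: "i < Suc m" for i
  proof (cases "i = m")
    case True
    then show ?thesis using reach_comp_le(2)[OF Suc.prems(1)[OF i] Suc.prems(2)[OF i] \<sigma>(1) \<tau>(1)] \<tau>(2) by simp
  next
    case False
    then show ?thesis
      using reach_comp_le(1)[OF Suc.prems(1)[OF i] Suc.prems(2)[OF i] \<sigma>(1) \<tau>(1)] \<sigma>(2)[of i] i by simp
  qed
  then show ?case using comp_op[OF \<sigma>(1) \<tau>(1)] by blast
qed

lemma radius_approx_two:
  assumes "E z" "A \<in> sets P" "E z'" "A' \<in> sets P" "\<epsilon> > 0"
  shows "\<exists>\<sigma>\<in>S. reach D A z \<sigma> < radius D A z + \<epsilon> \<and> reach D A' z' \<sigma> < radius D A' z' + \<epsilon>"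
proof -
  obtain \<sigma> where \<sigma>: "\<sigma> \<in> S" "reach D A z \<sigma> < radius D A z + \<epsilon>" using radius_approx[OF assms(5)] by blast
  obtain \<tau> where \<tau>: "\<tau> \<in> S" "reach D A' z' \<tau> < radius D A' z' + \<epsilon>" using radius_approx[OF assms(5)] by blast
  show ?thesis
    using comp_op[OF \<sigma>(1) \<tau>(1)] reach_comp_le(1)[OF assms(1,2) \<sigma>(1) \<tau>(1)]
      reach_comp_le(2)[OF assms(3,4) \<sigma>(1) \<tau>(1)] \<sigma>(2) \<tau>(2) by (meson order_le_less_trans)
qed

lemma reach_glue:
  assumes "E z" "E z'" "A \<in> sets P" "C \<in> sets P" "\<sigma> \<in> S"
  shows "reach D A (glue C z z') \<sigma> = reach D (A \<inter> C) z \<sigma> + reach D (A - C) z' \<sigma>"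
proof (rule antisym)
  have AC: "A \<inter> C \<in> sets P" "A - C \<in> sets P" using assms by auto
  show "reach D A (glue C z z') \<sigma> \<le> reach D (A \<inter> C) z \<sigma> + reach D (A - C) z' \<sigma>"
  proof (rule reach_least)
    fix x assume x: "x \<in> D"
    have "L1 A (glue C z z') (act \<sigma> x) = L1 (A \<inter> C) z (act \<sigma> x) + L1 (A - C) z' (act \<sigma> x)"
      using L1_glue[of z z' "act \<sigma> x" "act \<sigma> x" A C] assms E_act[OF assms(5) D_E[OF x]] by simp
    also have "\<dots> \<le> reach D (A \<inter> C) z \<sigma> + reach D (A - C) z' \<sigma>"
      by (intro add_mono L1_le_reach assms AC x)
    finally show "L1 A (glue C z z') (act \<sigma> x) \<le> reach D (A \<inter> C) z \<sigma> + reach D (A - C) z' \<sigma>" .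
  qed
  have 1: "L1 (A \<inter> C) z (act \<sigma> x) + L1 (A - C) z' (act \<sigma> x') \<le> reach D A (glue C z z') \<sigma>"
    if x: "x \<in> D" "x' \<in> D" for x x'
  proof -
    have "L1 (A \<inter> C) z (act \<sigma> x) + L1 (A - C) z' (act \<sigma> x') = L1 A (glue C z z') (act \<sigma> (glue C x x'))"
      unfolding act_glue by (rule L1_glue[symmetric]) (use assms x in \<open>auto intro: E_act D_E\<close>)
    also have "\<dots> \<le> reach D A (glue C z z') \<sigma>"
      by (rule L1_le_reach) (use assms x in \<open>auto intro: E_glue admissibleD(3)[OF D]\<close>)
    finally show ?thesis .
  qed
  have 2: "reach D (A \<inter> C) z \<sigma> \<le> reach D A (glue C z z') \<sigma> - L1 (A - C) z' (act \<sigma> x')" if "x' \<in> D" for x'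
    by (rule reach_least) (use 1[OF _ that] in force)
  have "reach D (A - C) z' \<sigma> \<le> reach D A (glue C z z') \<sigma> - reach D (A \<inter> C) z \<sigma>"
    by (rule reach_least) (use 2 in force)
  then show "reach D (A \<inter> C) z \<sigma> + reach D (A - C) z' \<sigma> \<le> reach D A (glue C z z') \<sigma>" by simp
qed

text \<open>
  Superadditivity comes from gluing the moved points, subadditivity from the fact that one operator
  can be nearly optimal for two conditions at the same time.
\<close>

lemma radius_glue:
  assumes "E z" "E z'" "A \<in> sets P" "C \<in> sets P"
  shows "radius D A (glue C z z') = radius D (A \<inter> C) z + radius D (A - C) z'"
proof (rule antisym)
  have AC: "A \<inter> C \<in> sets P" "A - C \<in> sets P" using assms by auto
  show "radius D A (glue C z z') \<le> radius D (A \<inter> C) z + radius D (A - C) z'"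
  proof (rule field_le_epsilon)
    fix \<epsilon> :: real assume "\<epsilon> > 0"
    then obtain \<sigma> where \<sigma>: "\<sigma> \<in> S" "reach D (A \<inter> C) z \<sigma> < radius D (A \<inter> C) z + \<epsilon>/2"
        "reach D (A - C) z' \<sigma> < radius D (A - C) z' + \<epsilon>/2"
      using radius_approx_two[OF assms(1) AC(1) assms(2) AC(2), of "\<epsilon>/2"] by auto
    have "radius D A (glue C z z') \<le> reach D A (glue C z z') \<sigma>"
      by (intro radius_le_reach E_glue assms \<sigma>)
    then show "radius D A (glue C z z') \<le> radius D (A \<inter> C) z + radius D (A - C) z' + \<epsilon>"
      using \<sigma> reach_glue[OF assms \<sigma>(1)] by simp
  qed
  show "radius D (A \<inter> C) z + radius D (A - C) z' \<le> radius D A (glue C z z')"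
  proof (rule radius_greatest)
    fix \<sigma> assume "\<sigma> \<in> S"
    then show "radius D (A \<inter> C) z + radius D (A - C) z' \<le> reach D A (glue C z z') \<sigma>"
      unfolding reach_glue[OF assms \<open>\<sigma> \<in> S\<close>] by (intro add_mono radius_le_reach assms AC)
  qed
qed

lemma radius_split:
  assumes "E z" "A \<in> sets P"
  shows "radius D (space P) z = radius D A z + radius D (space P - A) z"
  using radius_glue[OF assms(1,1) sets.top assms(2)] sets.sets_into_space[OF assms(2)]
  by (simp add: Int_absorb1)

lemma reach_split:
  assumes "E z" "A \<in> sets P" "\<sigma> \<in> S"
  shows "reach D (space P) z \<sigma> = reach D A z \<sigma> + reach D (space P - A) z \<sigma>"
  using reach_glue[OF assms(1,1) sets.top assms(2,3)] sets.sets_into_space[OF assms(2)]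
  by (simp add: Int_absorb1)

lemma radius_convex:
  assumes "E z" "E z'" "A \<in> sets P" "0 \<le> t" "t \<le> 1"
  shows "radius D A (\<lambda>\<omega>. (1 - t) *\<^sub>R z \<omega> + t *\<^sub>R z' \<omega>) \<le> (1 - t) * radius D A z + t * radius D A z'"
proof (rule field_le_epsilon)
  fix \<epsilon> :: real assume "\<epsilon> > 0"
  then obtain \<sigma> where \<sigma>: "\<sigma> \<in> S" "reach D A z \<sigma> < radius D A z + \<epsilon>" "reach D A z' \<sigma> < radius D A z' + \<epsilon>"
    using radius_approx_two[OF assms(1,3,2,3), of "\<epsilon>"] by auto
  let ?u = "\<lambda>\<omega>. (1 - t) *\<^sub>R z \<omega> + t *\<^sub>R z' \<omega>"
  have "radius D A ?u \<le> reach D A ?u \<sigma>"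
    by (rule radius_le_reach[OF E_mix[OF assms(1,2,4,5)] assms(3) \<sigma>(1)])
  also have "\<dots> \<le> (1 - t) * reach D A z \<sigma> + t * reach D A z' \<sigma>"
  proof (rule reach_least)
    fix x assume x: "x \<in> D"
    have "L1 A ?u (act \<sigma> x) \<le> (1 - t) * L1 A z (act \<sigma> x) + t * L1 A z' (act \<sigma> x)"
      by (intro L1_convex assms E_act \<sigma> D_E x)
    also have "\<dots> \<le> (1 - t) * reach D A z \<sigma> + t * reach D A z' \<sigma>"
      using assms(4,5) by (intro add_mono mult_left_mono L1_le_reach assms \<sigma> x) auto
    finally show "L1 A ?u (act \<sigma> x) \<le> (1 - t) * reach D A z \<sigma> + t * reach D A z' \<sigma>" .
  qed
  also have "\<dots> \<le> (1 - t) * (radius D A z + \<epsilon>) + t * (radius D A z' + \<epsilon>)"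
    using assms(4,5) \<sigma> by (intro add_mono mult_left_mono) auto
  also have "\<dots> = (1 - t) * radius D A z + t * radius D A z' + \<epsilon>" by (simp add: algebra_simps)
  finally show "radius D A ?u \<le> (1 - t) * radius D A z + t * radius D A z' + \<epsilon>" .
qed

lemma radius_lipschitz:
  assumes "E z" "E z'" "A \<in> sets P"
  shows "radius D A z \<le> radius D A z' + L1 A z z'"
proof -
  have "radius D A z - L1 A z z' \<le> radius D A z'"
  proof (rule radius_greatest)
    fix \<sigma> assume \<sigma>: "\<sigma> \<in> S"
    have "radius D A z \<le> reach D A z \<sigma>" by (intro radius_le_reach assms \<sigma>)
    also have "\<dots> \<le> L1 A z z' + reach D A z' \<sigma>"
    proof (rule reach_least)
      fix x assume x: "x \<in> D"
      have "L1 A z (act \<sigma> x) \<le> L1 A z z' + L1 A z' (act \<sigma> x)"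
        by (intro L1_triangle assms E_act \<sigma> D_E x)
      also have "\<dots> \<le> L1 A z z' + reach D A z' \<sigma>"
        by (intro add_left_mono L1_le_reach assms \<sigma> x)
      finally show "L1 A z (act \<sigma> x) \<le> L1 A z z' + reach D A z' \<sigma>" .
    qed
    finally show "radius D A z - L1 A z z' \<le> reach D A z' \<sigma>" by simp
  qed
  then show ?thesis by simp
qed

text \<open>
  Replacing \<open>\<sigma> D\<close> by the smaller set \<open>\<tau> \<sigma> D\<close> compares \<open>\<tau> z\<close> with points of the form \<open>\<tau> x\<close>, so
  nonexpansiveness applies.
\<close>

lemma radius_act_le:
  assumes "E z" "A \<in> sets P" "\<tau> \<in> S"
  shows "radius D A (act \<tau> z) \<le> radius D A z"
proof (rule radius_greatest)
  fix \<sigma> assume \<sigma>: "\<sigma> \<in> S"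
  let ?\<tau>\<sigma> = "\<lambda>\<omega> x. \<tau> \<omega> (\<sigma> \<omega> x)"
  have "radius D A (act \<tau> z) \<le> reach D A (act \<tau> z) ?\<tau>\<sigma>"
    by (rule radius_le_reach[OF E_act[OF assms(3,1)] assms(2) comp_op[OF assms(3) \<sigma>]])
  also have "\<dots> \<le> reach D A z \<sigma>"
  proof (rule reach_least)
    fix x assume x: "x \<in> D"
    have "act ?\<tau>\<sigma> x = act \<tau> (act \<sigma> x)" by (simp add: act_def)
    then have "L1 A (act \<tau> z) (act ?\<tau>\<sigma> x) \<le> L1 A z (act \<sigma> x)"
      using L1_act_le[OF assms(3,1) E_act[OF \<sigma> D_E[OF x]] assms(2)] by simp
    also have "\<dots> \<le> reach D A z \<sigma>" by (intro L1_le_reach assms \<sigma> x)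
    finally show "L1 A (act \<tau> z) (act ?\<tau>\<sigma> x) \<le> reach D A z \<sigma>" .
  qed
  finally show "radius D A (act \<tau> z) \<le> reach D A z \<sigma>" .
qed

lemma radius_le_sup:
  assumes "z \<in> D"
  shows "radius D (space P) z \<le> sup_radius D"
  unfolding sup_radius_def
proof (rule cSUP_upper[OF assms])
  show "bdd_above (radius D (space P) ` D)"
  proof (rule bdd_aboveI2[of _ _ diam_bound])
    fix z assume z: "z \<in> D"
    have "radius D (space P) z \<le> reach D (space P) z (\<lambda>\<omega> x. x)"
      by (intro radius_le_reach D_E z id_op sets.top)
    also have "\<dots> \<le> diam_bound"
    proof (rule reach_least)
      fix x assume x: "x \<in> D"
      show "L1 (space P) z (act (\<lambda>\<omega> x. x) x) \<le> diam_bound"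
        by (rule L1_le_diam_bound[OF D_E[OF z] E_act[OF id_op D_E[OF x]] sets.top])
    qed
    finally show "radius D (space P) z \<le> diam_bound" .
  qed
qed

lemma sup_radius_nonneg: "0 \<le> sup_radius D"
proof -
  obtain z where "z \<in> D" using admissibleD(1)[OF D] by auto
  then show ?thesis using radius_le_sup radius_nonneg[OF D_E sets.top] by (meson order_trans)
qed

lemma sup_radius_least: "(\<And>z. z \<in> D \<Longrightarrow> radius D (space P) z \<le> c) \<Longrightarrow> sup_radius D \<le> c"
  unfolding sup_radius_def by (rule cSUP_least[OF admissibleD(1)[OF D]])

text \<open>
  The bound is required over all events \<open>A\<close>, and not only over the whole space, since otherwise the
  set would not be closed under gluing.
\<close>

lemma admissible_sublevel:
  assumes z0: "z0 \<in> D"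
  shows "admissible {z\<in>D. \<forall>A\<in>sets P. radius D A z \<le> radius D A z0}"
  unfolding admissible_def
proof (intro conjI ballI allI impI)
  let ?F = "{z\<in>D. \<forall>A\<in>sets P. radius D A z \<le> radius D A z0}"
  show "?F \<noteq> {}" using z0 by auto
  show "E f" if "f \<in> ?F" for f using that D_E by auto
  show "glue C f g \<in> ?F" if fg: "f \<in> ?F" "g \<in> ?F" and C: "C \<in> sets P" for f g C
  proof -
    have "radius D A (glue C f g) \<le> radius D A z0" if A: "A \<in> sets P" for A
    proof -
      have "radius D A (glue C f g) = radius D (A \<inter> C) f + radius D (A - C) g"
        using fg by (intro radius_glue D_E A C) auto
      also have "\<dots> \<le> radius D (A \<inter> C) z0 + radius D (A - C) z0"
        using fg A C by (intro add_mono) auto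
      also have "\<dots> = radius D A z0"
        using radius_glue[of z0 z0 A C] D_E[OF z0] A C by simp
      finally show ?thesis .
    qed
    then show ?thesis using admissibleD(3)[OF D] fg C by auto
  qed
  show "(\<lambda>\<omega>. (1 - t) *\<^sub>R f \<omega> + t *\<^sub>R g \<omega>) \<in> ?F" if fg: "f \<in> ?F" "g \<in> ?F" and t: "t \<in> {0..1}" for f g t
  proof -
    have "radius D A (\<lambda>\<omega>. (1 - t) *\<^sub>R f \<omega> + t *\<^sub>R g \<omega>) \<le> radius D A z0" if A: "A \<in> sets P" for A
    proof -
      have "radius D A (\<lambda>\<omega>. (1 - t) *\<^sub>R f \<omega> + t *\<^sub>R g \<omega>) \<le> (1 - t) * radius D A f + t * radius D A g"
        using fg t by (intro radius_convex D_E A) auto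
      also have "\<dots> \<le> (1 - t) * radius D A z0 + t * radius D A z0"
        using fg A t by (intro add_mono mult_left_mono) auto
      finally show ?thesis by (simp add: algebra_simps)
    qed
    then show ?thesis using admissibleD(4)[OF D] fg t by auto
  qed
  show "f \<in> ?F" if f: "E f" and ap: "\<forall>\<epsilon>>0. \<exists>h\<in>?F. L1 (space P) f h < \<epsilon>" for f
  proof -
    have "f \<in> D" using ap by (intro admissibleD(5)[OF D f]) blast
    moreover have "radius D A f \<le> radius D A z0" if A: "A \<in> sets P" for A
    proof (rule field_le_epsilon)
      fix \<epsilon> :: real assume "\<epsilon> > 0"
      then obtain h where h: "h \<in> ?F" "L1 (space P) f h < \<epsilon>" using ap by blast
      have "radius D A f \<le> radius D A h + L1 A f h"
        using h by (intro radius_lipschitz f D_E A) auto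
      moreover have "L1 A f h \<le> L1 (space P) f h"
        using h A by (intro L1_mono f D_E A sets.top sets.sets_into_space) auto
      ultimately show "radius D A f \<le> radius D A z0 + \<epsilon>" using h A by fastforce
    qed
    ultimately show ?thesis by blast
  qed
  show "act \<sigma> f \<in> ?F" if \<sigma>: "\<sigma> \<in> S" and f: "f \<in> ?F" for \<sigma> f
  proof -
    have "radius D A (act \<sigma> f) \<le> radius D A z0" if "A \<in> sets P" for A
      using radius_act_le[OF D_E that \<sigma>, of f] f that by force
    then show ?thesis using admissibleD(6)[OF D \<sigma>] f by auto
  qed
qed

end

lemma radius_mono:
  assumes D: "admissible D" and F: "admissible F" "F \<subseteq> D" and z: "E z" and A: "A \<in> sets P"
  shows "radius F A z \<le> radius D A z"
proof (rule radius_greatest[OF D])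
  fix \<sigma> assume \<sigma>: "\<sigma> \<in> S"
  have "radius F A z \<le> reach F A z \<sigma>" by (rule radius_le_reach[OF F(1) z A \<sigma>])
  also have "\<dots> \<le> reach D A z \<sigma>"
    by (rule reach_least[OF F(1)]) (use F(2) in \<open>auto intro!: L1_le_reach[OF D z A \<sigma>]\<close>)
  finally show "radius F A z \<le> reach D A z \<sigma>" .
qed

lemma sup_radius_mono:
  assumes D: "admissible D" and F: "admissible F" "F \<subseteq> D"
  shows "sup_radius F \<le> sup_radius D"
proof (rule sup_radius_least[OF F(1)])
  fix z assume z: "z \<in> F"
  then have "radius F (space P) z \<le> radius D (space P) z"
    by (intro radius_mono D F admissibleD(2)[OF F(1)] sets.top)
  also have "\<dots> \<le> sup_radius D" using radius_le_sup[OF D] z F by blast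
  finally show "radius F (space P) z \<le> sup_radius D" .
qed

text \<open>
  Choosing each set of a decreasing sequence nearly optimal among the admissible subsets of its
  predecessor leaves no room for improvement in the intersection. This countable procedure takes the
  place of a minimal invariant set obtained from Zorn's lemma.
\<close>

lemma exists_minimal_admissible:
  "\<exists>D. admissible D \<and> (\<forall>F\<subseteq>D. admissible F \<longrightarrow> sup_radius D \<le> sup_radius F)"
proof -
  have "\<exists>D. \<forall>n. admissible (D n) \<and>
    (D (Suc n) \<subseteq> D n \<and> (\<forall>F\<subseteq>D n. admissible F \<longrightarrow> sup_radius (D (Suc n)) \<le> sup_radius F + 1 / real (Suc n)))"
  proof (rule dependent_nat_choice)
    show "\<exists>D. admissible D" using admissible_all by blast
    fix D and n :: nat assume D: "admissible D"
    define R where "R = sup_radius ` {F. F \<subseteq> D \<and> admissible F}"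
    have R: "R \<noteq> {}" "bdd_below R"
      using D by (auto simp: R_def intro!: bdd_belowI2[of _ 0] sup_radius_nonneg)
    have "Inf R < Inf R + 1 / real (Suc n)" by simp
    then obtain r where "r \<in> R" "r < Inf R + 1 / real (Suc n)"
      using cInf_less_iff[OF R] by blast
    then obtain D' where D': "D' \<subseteq> D" "admissible D'" "sup_radius D' < Inf R + 1 / real (Suc n)"
      by (auto simp: R_def)
    have "sup_radius D' \<le> sup_radius F + 1 / real (Suc n)" if "F \<subseteq> D" "admissible F" for F
      using D'(3) cInf_lower[OF _ R(2), of "sup_radius F"] that by (auto simp: R_def)
    then show "\<exists>D'. admissible D' \<and> (D' \<subseteq> D \<and> (\<forall>F\<subseteq>D. admissible F \<longrightarrow> sup_radius D' \<le> sup_radius F + 1 / real (Suc n)))"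
      using D' by blast
  qed
  then obtain D where D: "\<And>n. admissible (D n)" "\<And>n. D (Suc n) \<subseteq> D n"
     "\<And>n F. F \<subseteq> D n \<Longrightarrow> admissible F \<Longrightarrow> sup_radius (D (Suc n)) \<le> sup_radius F + 1 / real (Suc n)"
    by blast
  have adm: "admissible (\<Inter>n. D n)"
    by (rule admissible_Inter[where D = D, OF D(1)]) (rule decseq_SucI, rule D(2))
  moreover have "sup_radius (\<Inter>n. D n) \<le> sup_radius F" if F: "F \<subseteq> (\<Inter>n. D n)" "admissible F" for F
  proof (rule LIMSEQ_le_const)
    show "(\<lambda>n. sup_radius F + 1 / real (Suc n)) \<longlonglongrightarrow> sup_radius F"
      using tendsto_add[OF tendsto_const[of "sup_radius F"] LIMSEQ_Suc[OF lim_1_over_n]] by simp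
    have "sup_radius (\<Inter>n. D n) \<le> sup_radius F + 1 / real (Suc n)" for n
    proof -
      have "sup_radius (\<Inter>n. D n) \<le> sup_radius (D (Suc n))"
        by (rule sup_radius_mono[OF D(1) adm]) blast
      also have "\<dots> \<le> sup_radius F + 1 / real (Suc n)"
        using F by (intro D(3)) auto
      finally show ?thesis .
    qed
    then show "\<exists>N. \<forall>n\<ge>N. sup_radius (\<Inter>n. D n) \<le> sup_radius F + 1 / real (Suc n)" by blast
  qed
  ultimately show ?thesis by blast
qed

end

section \<open>Vanishing of the minimal radius\<close>

context commuting_operators
begin

context
  fixes D assumes D: "admissible D"
    and minimal: "\<And>F. F \<subseteq> D \<Longrightarrow> admissible F \<Longrightarrow> sup_radius D \<le> sup_radius F"
begin

text \<open>
  In the sublevel set at \<open>z\<close> all radii, and a fortiori those with respect to the smaller set, are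
  at most the radius at \<open>z\<close>. Were this below the supremum, minimality would be violated.
\<close>

lemma minimal_radius_space:
  assumes z: "z \<in> D"
  shows "radius D (space P) z = sup_radius D"
proof -
  let ?F = "{x\<in>D. \<forall>A\<in>sets P. radius D A x \<le> radius D A z}"
  have F: "admissible ?F" by (rule admissible_sublevel[OF D z])
  have "sup_radius D \<le> sup_radius ?F" by (rule minimal[OF _ F]) auto
  also have "\<dots> \<le> radius D (space P) z"
  proof (rule sup_radius_least[OF F])
    fix x assume x: "x \<in> ?F"
    then have "radius ?F (space P) x \<le> radius D (space P) x"
      by (intro radius_mono[OF D F]) (auto intro: D_E[OF D])
    also have "\<dots> \<le> radius D (space P) z" using x by blast
    finally show "radius ?F (space P) x \<le> radius D (space P) z" .
  qed
  finally show ?thesis using radius_le_sup[OF D z] by simp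
qed

text \<open>
  Gluing \<open>z\<close> on \<open>A\<close> with \<open>z'\<close> on the complement gives another element of \<open>D\<close>, whose radius over
  the whole space is again the common one.
\<close>

lemma minimal_radius_eq:
  assumes z: "z \<in> D" "z' \<in> D" and A: "A \<in> sets P"
  shows "radius D A z = radius D A z'"
proof -
  have "radius D A z + radius D (space P - A) z' = radius D (space P) (glue A z z')"
    using radius_glue[OF D D_E[OF D z(1)] D_E[OF D z(2)] sets.top A] sets.sets_into_space[OF A]
    by (simp add: Int_absorb1)
  also have "\<dots> = radius D (space P) z'"
    using minimal_radius_space[OF admissibleD(3)[OF D z A]] minimal_radius_space[OF z(2)] by simp
  also have "\<dots> = radius D A z' + radius D (space P - A) z'"
    by (rule radius_split[OF D D_E[OF D z(2)] A])
  finally show ?thesis by simp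
qed

text \<open>
  By the preceding lemma the choice of the representative does not matter.
\<close>

definition common_radius :: "'w set \<Rightarrow> real" where
  "common_radius A = radius D A (SOME z. z \<in> D)"

lemma common_radius: "z \<in> D \<Longrightarrow> A \<in> sets P \<Longrightarrow> radius D A z = common_radius A"
  unfolding common_radius_def by (rule minimal_radius_eq[OF _ someI[of "\<lambda>z. z \<in> D"]])

lemma common_radius_split: "A \<in> sets P \<Longrightarrow> common_radius (space P) = common_radius A + common_radius (space P - A)"
  using admissibleD(1)[OF D] radius_split[OF D D_E[OF D]] common_radius by (metis ex_in_conv sets.compl_sets sets.top)

lemma average_in:
  fixes y :: "nat \<Rightarrow> 'w \<Rightarrow> 'b"
  assumes "m > 0" "\<And>i. i < m \<Longrightarrow> y i \<in> D"
  shows "(\<lambda>\<omega>. (\<Sum>i<m. y i \<omega>) /\<^sub>R real m) \<in> D"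
  using assms
proof (induction m)
  case (Suc m)
  show ?case
  proof (cases "m = 0")
    case True
    then show ?thesis using Suc.prems by simp
  next
    case False
    define t where "t = 1 / real (Suc m)"
    have t: "0 \<le> t" "t \<le> 1" "1 - t = real m / real (Suc m)" by (auto simp: t_def field_simps)
    have "(\<lambda>\<omega>. (1 - t) *\<^sub>R ((\<Sum>i<m. y i \<omega>) /\<^sub>R real m) + t *\<^sub>R y m \<omega>) \<in> D"
      using False Suc by (intro admissibleD(4)[OF D] t) auto
    also have "(\<lambda>\<omega>. (1 - t) *\<^sub>R ((\<Sum>i<m. y i \<omega>) /\<^sub>R real m) + t *\<^sub>R y m \<omega>) = (\<lambda>\<omega>. (\<Sum>i<Suc m. y i \<omega>) /\<^sub>R real (Suc m))"
    proof
      fix \<omega>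
      have "(real m / real (Suc m)) * inverse (real m) = inverse (real (Suc m))"
        using False by (simp add: field_simps)
      then show "(1 - t) *\<^sub>R ((\<Sum>i<m. y i \<omega>) /\<^sub>R real m) + t *\<^sub>R y m \<omega> = (\<Sum>i<Suc m. y i \<omega>) /\<^sub>R real (Suc m)"
        unfolding t(3) scaleR_scaleR by (simp only: t_def sum.lessThan_Suc scaleR_add_right inverse_eq_divide)
    qed
    finally show ?thesis .
  qed
qed simp

text \<open>
  The bounds are over all events. No average exists for \<open>m = 0\<close>, where any element of \<open>D\<close> will do.
\<close>

definition next_point :: "(nat \<Rightarrow> 'w \<Rightarrow> 'b) \<Rightarrow> nat \<Rightarrow> ('w \<Rightarrow> 'b) \<Rightarrow> real \<Rightarrow> bool" where
  "next_point y m v \<epsilon> \<longleftrightarrow> v \<in> D \<and> (m > 0 \<longrightarrow> (\<forall>A\<in>sets P.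
     (\<forall>i<m. L1 A (y i) v \<le> common_radius A + \<epsilon>) \<and>
     L1 A (\<lambda>\<omega>. (\<Sum>i<m. y i \<omega>) /\<^sub>R real m) v \<le> common_radius A + \<epsilon> \<and>
     common_radius A - 2 * \<epsilon> \<le> L1 A (\<lambda>\<omega>. (\<Sum>i<m. y i \<omega>) /\<^sub>R real m) v))"

text \<open>
  An operator \<open>\<sigma>\<close> that is nearly optimal for all \<open>y i\<close> and for their average \<open>u\<close> makes every point of
  \<open>\<sigma> D\<close> satisfy the upper bounds, and some point of \<open>\<sigma> D\<close> is nearly as far from \<open>u\<close> as possible. Bounds over the
  whole space pass to each event because the radii of complementary events add up.
\<close>

lemma exists_next_point:
  assumes y: "\<And>i. i < m \<Longrightarrow> y i \<in> D" and \<epsilon>: "\<epsilon> > 0"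
  shows "\<exists>v. next_point y m v \<epsilon>"
proof (cases "m = 0")
  case True
  then show ?thesis using admissibleD(1)[OF D] by (auto simp: next_point_def)
next
  case False
  define u where "u = (\<lambda>\<omega>. (\<Sum>i<m. y i \<omega>) /\<^sub>R real m)"
  define z where "z i = (if i < m then y i else u)" for i
  have z: "z i \<in> D" for i
    using False y by (auto simp: z_def u_def intro: average_in)
  obtain \<sigma> where \<sigma>: "\<sigma> \<in> S" "\<And>i. i < Suc m \<Longrightarrow> reach D (space P) (z i) \<sigma> < common_radius (space P) + \<epsilon>"
    using radius_approx_many[OF D, of "Suc m" z "\<lambda>_. space P" \<epsilon>] D_E[OF D z] common_radius[OF z sets.top] \<epsilon> by auto
  have reach: "reach D A (z i) \<sigma> \<le> common_radius A + \<epsilon>" if i: "i < Suc m" and A: "A \<in> sets P" for i A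
  proof -
    have "common_radius (space P - A) \<le> reach D (space P - A) (z i) \<sigma>"
      using radius_le_reach[OF D D_E[OF D z] _ \<sigma>(1)] common_radius[OF z] A by (metis sets.compl_sets)
    then show ?thesis
      using reach_split[OF D D_E[OF D z] A \<sigma>(1), of i] \<sigma>(2)[OF i] common_radius_split[OF A] by simp
  qed
  obtain x where x: "x \<in> D" "L1 (space P) u (act \<sigma> x) > reach D (space P) u \<sigma> - \<epsilon>"
    using reach_approx[OF D \<epsilon>] by blast
  define v where "v = act \<sigma> x"
  have v: "v \<in> D" unfolding v_def by (rule admissibleD(6)[OF D \<sigma>(1) x(1)])
  have zm: "z m = u" by (simp add: z_def)
  have upper: "L1 A (z i) v \<le> common_radius A + \<epsilon>" if "i < Suc m" "A \<in> sets P" for i A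
    using L1_le_reach[OF D D_E[OF D z] that(2) \<sigma>(1) x(1)] reach[OF that] unfolding v_def by (meson order_trans)
  have lower: "common_radius A - 2 * \<epsilon> \<le> L1 A u v" if A: "A \<in> sets P" for A
  proof -
    have Eu: "E u" using D_E[OF D z[of m]] zm by simp
    have "L1 (space P) u v = L1 A u v + L1 (space P - A) u v"
      using L1_glue[OF Eu Eu D_E[OF D v] D_E[OF D v] sets.top A] sets.sets_into_space[OF A]
      by (simp add: Int_absorb1)
    moreover have "common_radius (space P) - \<epsilon> < L1 (space P) u v"
      using x(2) radius_le_reach[OF D Eu sets.top \<sigma>(1)] common_radius[OF z[of m] sets.top] zm by (simp add: v_def)
    moreover have "L1 (space P - A) u v \<le> common_radius (space P - A) + \<epsilon>"
      using upper[of m "space P - A"] A zm by simp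
    ultimately show ?thesis using common_radius_split[OF A] by simp
  qed
  have "next_point y m v \<epsilon>"
    unfolding next_point_def u_def[symmetric]
  proof (intro conjI ballI allI impI v lower)
    fix A i assume "A \<in> sets P" "i < m"
    then show "L1 A (y i) v \<le> common_radius A + \<epsilon>" using upper[of i A] by (simp add: z_def)
  next
    fix A assume "A \<in> sets P"
    then show "L1 A u v \<le> common_radius A + \<epsilon>" using upper[of m A] by (simp add: zm)
  qed
  then show ?thesis by blast
qed

text \<open>
  Markov's inequality for a difference of distances, with the comparison made on the event where the difference is
  large.
\<close>

lemma exceed_prob:
  assumes E: "E f" "E g" "E f'" "E g'" and \<delta>: "\<delta> > 0"
    and up: "\<And>A. A \<in> sets P \<Longrightarrow> L1 A f g \<le> common_radius A + \<epsilon>"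
    and low: "\<And>A. A \<in> sets P \<Longrightarrow> common_radius A - \<epsilon>' \<le> L1 A f' g'"
  shows "{\<omega>\<in>space P. dist (f' \<omega>) (g' \<omega>) + \<delta> < dist (f \<omega>) (g \<omega>)} \<in> sets P"
    and "prob {\<omega>\<in>space P. dist (f' \<omega>) (g' \<omega>) + \<delta> < dist (f \<omega>) (g \<omega>)} \<le> (\<epsilon> + \<epsilon>') / \<delta>"
proof -
  let ?A = "{\<omega>\<in>space P. dist (f' \<omega>) (g' \<omega>) + \<delta> < dist (f \<omega>) (g \<omega>)}"
  show A: "?A \<in> sets P"
    using strong_random_element_dist_measurable[OF E(1,2)] strong_random_element_dist_measurable[OF E(3,4)]
    by (intro borel_measurable_less borel_measurable_add) auto
  have "\<delta> * prob ?A = (\<integral>\<omega>. \<delta> * indicator ?A \<omega> \<partial>P)" using A by simp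
  also have "\<dots> \<le> (\<integral>\<omega>. indicator ?A \<omega> * dist (f \<omega>) (g \<omega>) - indicator ?A \<omega> * dist (f' \<omega>) (g' \<omega>) \<partial>P)"
  proof (rule integral_mono)
    show "integrable P (\<lambda>\<omega>. \<delta> * indicator ?A \<omega>)"
      using A by (intro integrable_mult_right integrable_real_indicator) (auto simp: emeasure_eq_measure)
    show "integrable P (\<lambda>\<omega>. indicator ?A \<omega> * dist (f \<omega>) (g \<omega>) - indicator ?A \<omega> * dist (f' \<omega>) (g' \<omega>))"
      by (intro Bochner_Integration.integrable_diff L1_integrable E A)
    fix \<omega> show "\<delta> * indicator ?A \<omega> \<le> indicator ?A \<omega> * dist (f \<omega>) (g \<omega>) - indicator ?A \<omega> * dist (f' \<omega>) (g' \<omega>)"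
      by (auto simp: indicator_def)
  qed
  also have "\<dots> = L1 ?A f g - L1 ?A f' g'"
    unfolding L1_def by (intro Bochner_Integration.integral_diff L1_integrable E A)
  also have "\<dots> \<le> \<epsilon> + \<epsilon>'" using up[OF A] low[OF A] by simp
  finally show "prob ?A \<le> (\<epsilon> + \<epsilon>') / \<delta>" using \<delta> by (simp add: pos_le_divide_eq mult.commute)
qed

text \<open>
  The integrated bounds on \<open>y m\<close> fail pointwise by more than \<open>(1/2)^m\<close> only with summable
  probabilities. So almost every path satisfies the hypotheses under which its distances to the
  averages tend to \<open>0\<close>; but their integrals are at least the common radius up to a vanishing error.
\<close>

lemma minimal_common_radius_zero:
  assumes V: "normal_structure V"
  shows "common_radius (space P) \<le> 0"
proof -
  \<comment> \<open>Divided by the threshold \<open>(1/2)^m\<close> and summed over the \<open>m\<close> earlier points, this error is still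
    summable over \<open>m\<close>.\<close>
  define \<epsilon> :: "nat \<Rightarrow> real" where "\<epsilon> m = (1/4)^m / real (Suc m)" for m
  have \<epsilon>_pos: "\<epsilon> m > 0" for m by (simp add: \<epsilon>_def)
  have "\<exists>y. \<forall>m. next_point y m (y m) (\<epsilon> m)"
  proof (rule dependent_wellorder_choice)
    fix v and f g :: "nat \<Rightarrow> 'w \<Rightarrow> 'b" and m :: nat assume "\<And>i. i < m \<Longrightarrow> f i = g i"
    then show "next_point f m v (\<epsilon> m) = next_point g m v (\<epsilon> m)" by (simp add: next_point_def)
  next
    fix m :: nat and f assume "\<And>i. i < m \<Longrightarrow> next_point f i (f i) (\<epsilon> i)"
    then show "\<exists>v. next_point f m v (\<epsilon> m)"
      by (intro exists_next_point \<epsilon>_pos) (auto simp: next_point_def)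
  qed
  then obtain y where y: "\<And>m. next_point y m (y m) (\<epsilon> m)" by blast
  define u where "u m = (\<lambda>\<omega>. (\<Sum>i<m. y i \<omega>) /\<^sub>R real m)" for m
  have yD: "y m \<in> D" for m using y[of m] by (simp add: next_point_def)
  have Ey: "E (y m)" for m by (rule D_E[OF D yD])
  have Eu: "E (u m)" if "m > 0" for m unfolding u_def by (intro D_E[OF D] average_in yD that)
  have near: "L1 A (y i) (y m) \<le> common_radius A + \<epsilon> m" if "i < m" "A \<in> sets P" for i m A
    using y[of m] that by (simp add: next_point_def)
  have u_near: "L1 A (u m) (y m) \<le> common_radius A + \<epsilon> m" if "m > 0" "A \<in> sets P" for m A
    using y[of m] that by (simp add: next_point_def u_def)
  have u_far: "common_radius A - 2 * \<epsilon> m \<le> L1 A (u m) (y m)" if "m > 0" "A \<in> sets P" for m A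
    using y[of m] that by (simp add: next_point_def u_def)
  define a where "a m \<omega> = dist (u m \<omega>) (y m \<omega>)" for m \<omega>
  define N1 where "N1 m i = {\<omega>\<in>space P. dist (u m \<omega>) (y m \<omega>) + (1/2)^m < dist (y i \<omega>) (y m \<omega>)}" for m i
  define N2 where "N2 m = {\<omega>\<in>space P. dist (u (Suc m) \<omega>) (y (Suc m) \<omega>) + (1/2)^m < dist (u m \<omega>) (y m \<omega>)}" for m
  define N3 where "N3 m = {\<omega>\<in>space P. dist (u m \<omega>) (y m \<omega>) + (1/2)^m < dist (u (Suc m) \<omega>) (y (Suc m) \<omega>)}" for m
  have half: "(1/2::real)^m > 0" for m by simp
  have N1: "N1 m i \<in> sets P" "prob (N1 m i) \<le> (\<epsilon> m + 2 * \<epsilon> m) / (1/2)^m" if "i < m" for m i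
  proof -
    have m: "m > 0" using that by simp
    show "N1 m i \<in> sets P" "prob (N1 m i) \<le> (\<epsilon> m + 2 * \<epsilon> m) / (1/2)^m" unfolding N1_def
      by (rule exceed_prob[OF Ey[of i] Ey[of m] Eu[OF m] Ey[of m] half near[OF that] u_far[OF m]]; assumption)+
  qed
  have N2: "N2 m \<in> sets P" "prob (N2 m) \<le> (\<epsilon> m + 2 * \<epsilon> (Suc m)) / (1/2)^m" if m: "m > 0" for m
    unfolding N2_def
    by (rule exceed_prob[OF Eu[OF m] Ey[of m] Eu[OF zero_less_Suc] Ey[of "Suc m"] half u_near[OF m] u_far[OF zero_less_Suc]]; assumption)+
  have N3: "N3 m \<in> sets P" "prob (N3 m) \<le> (\<epsilon> (Suc m) + 2 * \<epsilon> m) / (1/2)^m" if m: "m > 0" for m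
    unfolding N3_def
    by (rule exceed_prob[OF Eu[OF zero_less_Suc] Ey[of "Suc m"] Eu[OF m] Ey[of m] half u_near[OF zero_less_Suc] u_far[OF m]]; assumption)+
  \<comment> \<open>The averages \<open>u m\<close> are meaningful only from \<open>m = 1\<close> on.\<close>
  define Bad where "Bad m = (if m = 0 then {} else (\<Union>i<m. N1 m i) \<union> (N2 m \<union> N3 m))" for m
  have Bad: "Bad m \<in> sets P" for m using N1(1) N2(1) N3(1) by (auto simp: Bad_def)
  have eps_le: "\<epsilon> (Suc m) \<le> \<epsilon> m" for m
  proof -
    have "(1/4::real)^Suc m / real (Suc (Suc m)) \<le> (1/4)^m / real (Suc m)"
      by (intro frac_le) auto
    then show ?thesis by (simp only: \<epsilon>_def)
  qed
  have quarter: "(1/4::real)^m / (1/2)^m = (1/2)^m" for m by (simp flip: power_divide)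
  have eps_half: "\<epsilon> m / (1/2)^m \<le> (1/2)^m" "real m * (\<epsilon> m / (1/2)^m) \<le> (1/2)^m" for m
  proof -
    have *: "\<epsilon> m / (1/2)^m = (1/2)^m / real (Suc m)"
      unfolding \<epsilon>_def by (metis quarter divide_divide_eq_left mult.commute)
    show "\<epsilon> m / (1/2)^m \<le> (1/2)^m" unfolding * by (simp add: divide_le_eq mult_le_cancel_left1)
    have "real m * ((1/2)^m / real (Suc m)) = (1/2)^m * (real m / real (Suc m))" by simp
    also have "\<dots> \<le> (1/2)^m * 1" by (intro mult_left_mono) auto
    finally show "real m * (\<epsilon> m / (1/2)^m) \<le> (1/2)^m" unfolding * by simp
  qed
  have prob_Bad: "prob (Bad m) \<le> 9 * (1/2)^m" for m
  proof (cases "m = 0")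
    case False
    then have m: "m > 0" by simp
    have "prob (\<Union>i<m. N1 m i) \<le> (\<Sum>i<m. prob (N1 m i))"
      by (rule finite_measure_subadditive_finite) (use N1(1) in auto)
    also have "\<dots> \<le> (\<Sum>i<m. 3 * (\<epsilon> m / (1/2)^m))"
      by (rule sum_mono) (use N1(2) in \<open>simp add: field_simps\<close>)
    also have "\<dots> = 3 * (real m * (\<epsilon> m / (1/2)^m))" by simp
    also have "\<dots> \<le> 3 * (1/2)^m" using eps_half(2)[of m] by linarith
    finally have 1: "prob (\<Union>i<m. N1 m i) \<le> 3 * (1/2)^m" .
    have e: "\<epsilon> (Suc m) / (1/2)^m \<le> \<epsilon> m / (1/2)^m" by (rule divide_right_mono[OF eps_le]) simp
    have 2: "prob (N2 m) \<le> 3 * (1/2)^m"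
      using N2(2)[OF m] e eps_half(1)[of m] unfolding add_divide_distrib times_divide_eq_right[symmetric] by linarith
    have 3: "prob (N3 m) \<le> 3 * (1/2)^m"
      using N3(2)[OF m] e eps_half(1)[of m] unfolding add_divide_distrib times_divide_eq_right[symmetric] by linarith
    have "prob (Bad m) \<le> prob (\<Union>i<m. N1 m i) + (prob (N2 m) + prob (N3 m))"
    proof -
      have "prob (Bad m) \<le> prob (\<Union>i<m. N1 m i) + prob (N2 m \<union> N3 m)"
        unfolding Bad_def using False N1(1) N2(1)[OF m] N3(1)[OF m] by (auto intro!: measure_Un_le)
      moreover have "prob (N2 m \<union> N3 m) \<le> prob (N2 m) + prob (N3 m)"
        by (intro measure_Un_le N2 N3 m)
      ultimately show ?thesis by linarith
    qed
    then show ?thesis using 1 2 3 by linarith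
  qed (simp add: Bad_def)
  have "summable (\<lambda>m. prob (Bad m))"
  proof (rule summable_comparison_test)
    show "\<exists>N. \<forall>m\<ge>N. norm (prob (Bad m)) \<le> 9 * (1/2)^m" using prob_Bad by simp
    show "summable (\<lambda>m. 9 * (1/2::real)^m)" by (intro summable_mult summable_geometric) simp
  qed
  then have "AE \<omega> in P. eventually (\<lambda>m. \<omega> \<in> space P - Bad m) sequentially"
    by (intro borel_cantelli_AE1 Bad) (auto simp: emeasure_eq_measure)
  then have "AE \<omega> in P. (\<lambda>m. dist (u m \<omega>) (y m \<omega>)) \<longlonglongrightarrow> 0"
    using AE_space
  proof eventually_elim
    case (elim \<omega>)
    have ev: "eventually (\<lambda>m. m > 0 \<and> \<omega> \<in> space P - Bad m) sequentially"
      using eventually_gt_at_top[of 0] elim(1) by eventually_elim simp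
    have "(\<lambda>m. norm (y m \<omega> - (\<Sum>i<m. y i \<omega>) /\<^sub>R real m)) \<longlonglongrightarrow> 0"
    proof (rule radii_tend_to_zero[OF V decseq_Inter])
      show "y n \<omega> \<in> V" for n by (rule strong_random_element_in[OF Ey elim(2)])
      show "eventually (\<lambda>m. \<forall>i<m. norm (y m \<omega> - y i \<omega>) \<le> norm (y m \<omega> - (\<Sum>i<m. y i \<omega>) /\<^sub>R real m) + (1/2)^m) sequentially"
        using ev
      proof eventually_elim
        case (elim m)
        then show ?case by (auto simp: Bad_def N1_def u_def dist_norm norm_minus_commute not_less)
      qed
      show "eventually (\<lambda>m. \<bar>norm (y m \<omega> - (\<Sum>i<m. y i \<omega>) /\<^sub>R real m) -
          norm (y (Suc m) \<omega> - (\<Sum>i<Suc m. y i \<omega>) /\<^sub>R real (Suc m))\<bar> \<le> (1/2)^m) sequentially"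
        using ev
      proof eventually_elim
        case (elim m)
        then have "a m \<omega> \<le> a (Suc m) \<omega> + (1/2)^m" "a (Suc m) \<omega> \<le> a m \<omega> + (1/2)^m"
          by (auto simp: Bad_def N2_def N3_def a_def not_less)
        then have "\<bar>a m \<omega> - a (Suc m) \<omega>\<bar> \<le> (1/2)^m" by linarith
        then show ?case unfolding a_def u_def dist_norm norm_minus_commute[of "y _ \<omega>"] .
      qed
    qed
    then show ?case unfolding u_def dist_norm norm_minus_commute[of "y _ \<omega>"] .
  qed
  then have "AE \<omega> in P. (\<lambda>m. dist (u (Suc m) \<omega>) (y (Suc m) \<omega>)) \<longlonglongrightarrow> 0"
    by eventually_elim (rule LIMSEQ_Suc)
  then have L: "(\<lambda>m. L1 (space P) (u (Suc m)) (y (Suc m))) \<longlonglongrightarrow> 0"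
    by (intro L1_tendsto_zero Ey Eu) simp
  have \<epsilon>0: "(\<lambda>m. 2 * \<epsilon> (Suc m)) \<longlonglongrightarrow> 0" unfolding \<epsilon>_def by real_asymp
  show ?thesis
  proof (rule LIMSEQ_le_const)
    show "(\<lambda>m. L1 (space P) (u (Suc m)) (y (Suc m)) + 2 * \<epsilon> (Suc m)) \<longlonglongrightarrow> 0"
      using tendsto_add[OF L \<epsilon>0] by simp
    have "common_radius (space P) \<le> L1 (space P) (u (Suc m)) (y (Suc m)) + 2 * \<epsilon> (Suc m)" for m
      using u_far[of "Suc m" "space P"] by simp
    then show "\<exists>N. \<forall>m\<ge>N. common_radius (space P) \<le> L1 (space P) (u (Suc m)) (y (Suc m)) + 2 * \<epsilon> (Suc m)" by blast
  qed
qed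

text \<open>
  The radius \<open>0\<close> puts some \<open>\<tau> f\<close> close to both \<open>f\<close> and \<open>\<sigma> f\<close>.
\<close>

lemma minimal_fixed_point:
  assumes V: "normal_structure V" and f: "f \<in> D" and \<sigma>: "\<sigma> \<in> S"
  shows "AE \<omega> in P. \<sigma> \<omega> (f \<omega>) = f \<omega>"
proof -
  have g: "act \<sigma> f \<in> D" by (rule admissibleD(6)[OF D \<sigma> f])
  have Ef: "E f" and Eg: "E (act \<sigma> f)" using D_E[OF D] f g by auto
  have rad0: "radius D (space P) z \<le> 0" if "z \<in> D" for z
    using common_radius[OF that sets.top] minimal_common_radius_zero[OF V] by simp
  have "L1 (space P) (act \<sigma> f) f \<le> 0"
  proof (rule field_le_epsilon)
    fix \<epsilon> :: real assume "\<epsilon> > 0"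
    then obtain \<tau> where \<tau>: "\<tau> \<in> S" "reach D (space P) (act \<sigma> f) \<tau> < \<epsilon>/2" "reach D (space P) f \<tau> < \<epsilon>/2"
      using radius_approx_two[OF D Eg sets.top Ef sets.top, of "\<epsilon>/2"] rad0[OF f] rad0[OF g] by force
    have "L1 (space P) (act \<sigma> f) f \<le> L1 (space P) (act \<sigma> f) (act \<tau> f) + L1 (space P) (act \<tau> f) f"
      by (rule L1_triangle[OF Eg E_act[OF \<tau>(1) Ef] Ef sets.top])
    also have "\<dots> \<le> reach D (space P) (act \<sigma> f) \<tau> + reach D (space P) f \<tau>"
      using L1_le_reach[OF D Eg sets.top \<tau>(1) f] L1_le_reach[OF D Ef sets.top \<tau>(1) f] by (simp add: L1_commute)
    finally show "L1 (space P) (act \<sigma> f) f \<le> 0 + \<epsilon>" using \<tau> by simp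
  qed
  then have "L1 (space P) (act \<sigma> f) f = 0" using L1_nonneg[of "space P" "act \<sigma> f" f] by simp
  then show ?thesis using L1_zero_AE[OF Eg Ef] by (simp add: act_def)
qed

end

lemma common_fixed_point:
  assumes "normal_structure V"
  shows "\<exists>f. E f \<and> (\<forall>\<sigma>\<in>S. AE \<omega> in P. \<sigma> \<omega> (f \<omega>) = f \<omega>)"
proof -
  obtain D where D: "admissible D" "\<And>F. F \<subseteq> D \<Longrightarrow> admissible F \<Longrightarrow> sup_radius D \<le> sup_radius F"
    using exists_minimal_admissible by blast
  obtain f where f: "f \<in> D" using admissibleD(1)[OF D(1)] by blast
  then show ?thesis
    using minimal_fixed_point[OF D assms f] admissibleD(2)[OF D(1) f] by blast
qed

end

section \<open>The generated monoid and the fixed point theorem\<close>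

text \<open>
  The monoid is needed to make the sets \<open>\<sigma> D\<close> directed.
\<close>

inductive_set generated_operators :: "('w \<Rightarrow> 'b \<Rightarrow> 'b) set \<Rightarrow> ('w \<Rightarrow> 'b \<Rightarrow> 'b) set" for \<T> where
  identity: "(\<lambda>\<omega> x. x) \<in> generated_operators \<T>"
| compose: "T \<in> \<T> \<Longrightarrow> \<sigma> \<in> generated_operators \<T> \<Longrightarrow> (\<lambda>\<omega> x. T \<omega> (\<sigma> \<omega> x)) \<in> generated_operators \<T>"

lemma generated_operators_comp:
  assumes "\<sigma> \<in> generated_operators \<T>" "\<tau> \<in> generated_operators \<T>"
  shows "(\<lambda>\<omega> x. \<sigma> \<omega> (\<tau> \<omega> x)) \<in> generated_operators \<T>"
  using assms(1) by induction (auto intro: assms(2) generated_operators.compose)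

lemma generated_operators_superset: "T \<in> \<T> \<Longrightarrow> T \<in> generated_operators \<T>"
  using generated_operators.compose[OF _ generated_operators.identity, of T \<T>] by simp

lemma nonexpansive_operator_maps:
  assumes "strong_random_nonexpansive_operator P S S' T" "\<omega> \<in> space P" "x \<in> S"
  shows "T \<omega> x \<in> S'"
  using strong_random_element_in[of P S' "\<lambda>\<omega>. T \<omega> x" \<omega>] assms
  by (simp add: strong_random_nonexpansive_operator_def strong_random_operator_def)

lemma strong_random_nonexpansive_operator_comp:
  assumes T: "strong_random_nonexpansive_operator P S S' T"
    and U: "strong_random_nonexpansive_operator P R S U" and S': "closed S'"
  shows "strong_random_nonexpansive_operator P R S' (\<lambda>\<omega> x. T \<omega> (U \<omega> x))"
proof -
  have "strong_random_element P S' (\<lambda>\<omega>. T \<omega> (U \<omega> x))" if "x \<in> R" for x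
    using U that by (intro strong_random_operator_apply[OF T S'])
      (simp add: strong_random_nonexpansive_operator_def strong_random_operator_def)
  moreover have "dist (T \<omega> (U \<omega> x)) (T \<omega> (U \<omega> y)) \<le> dist x y"
    if "\<omega> \<in> space P" "x \<in> R" "y \<in> R" for \<omega> x y
  proof -
    have "dist (T \<omega> (U \<omega> x)) (T \<omega> (U \<omega> y)) \<le> dist (U \<omega> x) (U \<omega> y)"
      using T that nonexpansive_operator_maps[OF U]
      by (simp add: strong_random_nonexpansive_operator_def random_nonexpansive_def)
    also have "\<dots> \<le> dist x y"
      using U that by (simp add: strong_random_nonexpansive_operator_def random_nonexpansive_def)
    finally show ?thesis .
  qed
  ultimately show ?thesis
    by (simp add: strong_random_nonexpansive_operator_def strong_random_operator_def random_nonexpansive_def)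
qed

lemma generated_operators_nonexpansive:
  assumes \<T>: "\<And>T. T \<in> \<T> \<Longrightarrow> strong_random_nonexpansive_operator P V V T" and V: "closed V"
    and "\<sigma> \<in> generated_operators \<T>"
  shows "strong_random_nonexpansive_operator P V V \<sigma>"
  using assms(3)
proof induction
  case identity
  show ?case
    by (simp add: strong_random_nonexpansive_operator_def strong_random_operator_def
        random_nonexpansive_def strong_random_element_const)
next
  case (compose T \<sigma>)
  show ?case
    by (rule strong_random_nonexpansive_operator_comp[OF \<T>[OF compose.hyps(1)] compose.IH V])
qed

text \<open>
  The induction on \<open>\<sigma>\<close> reduces to a single member of the family, for which a second induction
  on \<open>\<tau>\<close> applies.
\<close>

lemma generated_operators_commute:
  assumes \<T>: "\<And>T. T \<in> \<T> \<Longrightarrow> strong_random_nonexpansive_operator P V V T" and V: "closed V"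
    and comm: "commutative_family P V \<T>"
    and \<sigma>: "\<sigma> \<in> generated_operators \<T>" and \<tau>: "\<tau> \<in> generated_operators \<T>"
    and \<omega>: "\<omega> \<in> space P" and x: "x \<in> V"
  shows "\<sigma> \<omega> (\<tau> \<omega> x) = \<tau> \<omega> (\<sigma> \<omega> x)"
proof -
  have maps: "\<rho> \<omega> x \<in> V" if "\<rho> \<in> generated_operators \<T>" "x \<in> V" for \<rho> x
    by (rule nonexpansive_operator_maps[OF generated_operators_nonexpansive[OF \<T> V that(1)] \<omega> that(2)])
  have 1: "T \<omega> (\<rho> \<omega> x) = \<rho> \<omega> (T \<omega> x)" if T: "T \<in> \<T>" and "\<rho> \<in> generated_operators \<T>" "x \<in> V" for T \<rho> x
    using that(2)
  proof induction
    case (compose U \<rho>)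
    have "T \<omega> (U \<omega> (\<rho> \<omega> x)) = U \<omega> (T \<omega> (\<rho> \<omega> x))"
      using comm T compose.hyps(1) \<omega> maps[OF compose.hyps(2) \<open>x \<in> V\<close>]
      by (simp add: commutative_family_def commutative_operators_def)
    then show ?case using compose.IH by simp
  qed simp
  show ?thesis using \<sigma>
  proof induction
    case (compose T \<sigma>)
    then show ?case using 1[OF compose.hyps(1) \<tau> maps[OF compose.hyps(2) x]] by simp
  qed simp
qed

theorem theorem1p18:
  fixes P :: "'w measure"
    and K :: "complex set"
    and smul :: "complex \<Rightarrow> 'b::banach \<Rightarrow> 'b"
    and V :: "'b set"
    and \<T> :: "('w \<Rightarrow> 'b \<Rightarrow> 'b) set"
  assumes "prob_space P"
    and "banach_space_over K smul"
    and "weakly_compact K smul V"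
    and "convex V"
    and "normal_structure V"
    and "\<And>T. T \<in> \<T> \<Longrightarrow> strong_random_nonexpansive_operator P V V T"
    and "commutative_family P V \<T>"
  shows "\<exists>x\<^sub>0 :: 'w \<Rightarrow> 'b. strong_random_element P V x\<^sub>0 \<and>
           (\<forall>T\<in>\<T>. AE \<omega> in P. T \<omega> (x\<^sub>0 \<omega>) = x\<^sub>0 \<omega>)"
proof -
  have V: "closed V" "bounded V" "V \<noteq> {}" using assms(5) by (auto simp: normal_structure_def)
  interpret prob_space P by fact
  interpret random_convex_set P V
    by unfold_locales (use V assms(4) weakly_compact_decseq_Inter[OF assms(2,3)] in auto)
  interpret commuting_operators P V "generated_operators \<T>"
  proof unfold_locales
    show "strong_random_nonexpansive_operator P V V \<sigma>" if "\<sigma> \<in> generated_operators \<T>" for \<sigma>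
      by (rule generated_operators_nonexpansive[OF assms(6) V(1) that])
    show "\<sigma> \<omega> (\<tau> \<omega> x) = \<tau> \<omega> (\<sigma> \<omega> x)"
      if "\<sigma> \<in> generated_operators \<T>" "\<tau> \<in> generated_operators \<T>" "\<omega> \<in> space P" "x \<in> V" for \<sigma> \<tau> \<omega> x
      by (rule generated_operators_commute[OF assms(6) V(1) assms(7) that])
  qed (auto intro: generated_operators.identity generated_operators_comp)
  obtain f where "strong_random_element P V f"
      "\<And>\<sigma>. \<sigma> \<in> generated_operators \<T> \<Longrightarrow> AE \<omega> in P. \<sigma> \<omega> (f \<omega>) = f \<omega>"
    using common_fixed_point[OF assms(5)] by blast
  then show ?thesis using generated_operators_superset by blast
qed

end
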